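(* Let $\sigma(u)$, $-\infty<u<\infty$, be a distribution function, and suppose that $\sigma$ generates finite moments of all orders $n\in\mathbb{Z}$. Let $$\mu_n=\int_{-\infty}^{\infty}u^n\,d\sigma(u),\qquad n\in\mathbb{Z}.$$ If $$\int_{-\infty}^{\infty}\frac{\log\sigma'(u)}{1+u^2}\,du>-\infty,$$ where $\sigma'(u)$ is the derivative of the absolutely continuous part of $\sigma(u)$, then the strong Hamburger moment problem with moment sequence $\{\mu_n\}_{n\in\mathbb{Z}}$ is indeterminate.
   Context: A distribution function on an interval $I\subset\mathbb{R}$ is a real-valued, bounded, non-decreasing function on $I$ having infinitely many points of increase in $I$. Two distribution functions $\alpha_1,\alpha_2$ on $I$ are regarded as equal if $\int_I f\,d\alpha_1=\int_I f\,d\alpha_2$ for all continuous functions $f$ with compact support. The moment of order $n\in\mathbb{Z}$ of $\sigma$ on $I$ is $\int_I u^n\,d\sigma(u)$; "finite moments of all orders" means that these are finite for all $n\in\mathbb{Z}$ (positive, zero and negative); in particular $\sigma$ has no mass at the origin. The strong Hamburger moment problem for a real sequence $\{\mu_n\}_{n\in\mathbb{Z}}$ is: find a distribution function $\alpha$ on $]-\infty,\infty[$ such that $\mu_n=\int_{-\infty}^{\infty}x^n\,d\alpha(x)$ for all $n\in\mathbb{Z}$. It is determinate if it has at most one solution $\alpha$ (up to the equality above), and indeterminate otherwise. *)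

theory Defs
  imports "HOL-Analysis.Analysis" "HOL-Probability.Distribution_Functions"
begin

definition point_of_increase :: "(real \<Rightarrow> real) \<Rightarrow> real \<Rightarrow> bool" where
  "point_of_increase \<alpha> x \<longleftrightarrow> (\<forall>\<epsilon>>0. \<alpha> (x - \<epsilon>) < \<alpha> (x + \<epsilon>))"

text \<open>Distribution functions on the whole line; no one-sided continuity is required.\<close>

definition distribution_function :: "(real \<Rightarrow> real) \<Rightarrow> bool" where
  "distribution_function \<alpha> \<longleftrightarrow>
     mono \<alpha> \<and> bounded (range \<alpha>) \<and> infinite {x. point_of_increase \<alpha> x}"

text \<open>The Lebesgue-Stieltjes measure of a non-decreasing function.
  \<^const>\<open>interval_measure\<close> is only meaningful for right-continuous functions, so it is applied to
  the right-continuous modification, mapping \<open>x\<close> to \<open>\<alpha>(x+)\<close>. This does not affect integrals with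
  respect to \<open>d\<alpha>\<close>.\<close>

definition stieltjes_measure :: "(real \<Rightarrow> real) \<Rightarrow> real measure" where
  "stieltjes_measure \<alpha> = interval_measure (\<lambda>x. Lim (at_right x) \<alpha>)"

definition same_distribution :: "(real \<Rightarrow> real) \<Rightarrow> (real \<Rightarrow> real) \<Rightarrow> bool" where
  "same_distribution \<alpha> \<beta> \<longleftrightarrow>
     (\<forall>f :: real \<Rightarrow> real. continuous_on UNIV f \<and> compact (closure {x. f x \<noteq> 0}) \<longrightarrow>
        (LINT x|stieltjes_measure \<alpha>. f x) = (LINT x|stieltjes_measure \<beta>. f x))"

text \<open>Since \<open>0 powi n = 0\<close> for negative \<open>n\<close> in HOL, the absence of mass at the origin, which
  finiteness of the moments of negative order entails, has to be required explicitly.\<close>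

definition finite_moments :: "(real \<Rightarrow> real) \<Rightarrow> bool" where
  "finite_moments \<alpha> \<longleftrightarrow>
     emeasure (stieltjes_measure \<alpha>) {0} = 0 \<and>
     (\<forall>n::int. integrable (stieltjes_measure \<alpha>) (\<lambda>u. u powi n))"

definition moment :: "(real \<Rightarrow> real) \<Rightarrow> int \<Rightarrow> real" where
  "moment \<alpha> n = (LINT u|stieltjes_measure \<alpha>. u powi n)"

definition strong_hamburger_solution :: "(int \<Rightarrow> real) \<Rightarrow> (real \<Rightarrow> real) \<Rightarrow> bool" where
  "strong_hamburger_solution \<mu> \<alpha> \<longleftrightarrow>
     distribution_function \<alpha> \<and> finite_moments \<alpha> \<and> (\<forall>n. \<mu> n = moment \<alpha> n)"

definition strong_hamburger_determinate :: "(int \<Rightarrow> real) \<Rightarrow> bool" where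
  "strong_hamburger_determinate \<mu> \<longleftrightarrow>
     (\<forall>\<alpha> \<beta>. strong_hamburger_solution \<mu> \<alpha> \<and> strong_hamburger_solution \<mu> \<beta> \<longrightarrow>
        same_distribution \<alpha> \<beta>)"

definition strong_hamburger_indeterminate :: "(int \<Rightarrow> real) \<Rightarrow> bool" where
  "strong_hamburger_indeterminate \<mu> \<longleftrightarrow> \<not> strong_hamburger_determinate \<mu>"

text \<open>\<open>N\<close> is the absolutely continuous component, and \<open>S\<close> the singular one, in the Lebesgue
  decomposition of \<open>M\<close> with respect to Lebesgue measure.\<close>

definition absolutely_continuous_part :: "real measure \<Rightarrow> real measure \<Rightarrow> bool" where
  "absolutely_continuous_part M N \<longleftrightarrow>
     sets N = sets borel \<and> absolutely_continuous lborel N \<and>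
     (\<exists>S Z. sets S = sets borel \<and> Z \<in> null_sets lborel \<and> emeasure S (- Z) = 0 \<and>
        (\<forall>A\<in>sets borel. emeasure M A = emeasure N A + emeasure S A))"

text \<open>Logarithm with \<open>log 0 = -\<infinity>\<close>, in contrast to the HOL convention \<open>ln 0 = 0\<close>.\<close>

definition ext_log :: "real \<Rightarrow> ereal" where
  "ext_log x = (if x \<le> 0 then - \<infinity> else ereal (ln x))"

text \<open>Integral of an extended real valued function, as the integral of its positive part minus
  that of its negative part. It is only meaningful if one of the two is finite; for
  \<open>log \<sigma>'(u) / (1 + u\<^sup>2)\<close> the positive part is dominated by \<open>\<sigma>'\<close>, hence integrable.\<close>

definition ext_integral :: "'a measure \<Rightarrow> ('a \<Rightarrow> ereal) \<Rightarrow> ereal" where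
  "ext_integral M f =
     enn2ereal (\<integral>\<^sup>+ x. e2ennreal (f x) \<partial>M) - enn2ereal (\<integral>\<^sup>+ x. e2ennreal (- f x) \<partial>M)"

end

theory Submission
  imports Defs "HOL-Complex_Analysis.Cauchy_Integral_Formula"
    "HOL-Computational_Algebra.Fundamental_Theorem_Algebra"
begin

text \<open>
  Write \<open>M\<close> for the measure \<open>d\<sigma>\<close> and \<open>w\<close> for the density of its absolutely continuous part. The
  logarithmic integral condition says that \<open>ln w\<close> is integrable with respect to the Cauchy
  distribution \<open>C\<close>, which is the harmonic measure of the upper half-plane seen from \<open>\<i>\<close>. Hence point
  evaluation at \<open>\<i>\<close> is a bounded functional on Laurent polynomials in a weighted
  \<open>L\<^sup>1\<close>-norm: for a polynomial \<open>q\<close> and the Laurent polynomial \<open>p(t) = q(t) / t\<^sup>m\<close>, the function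
  \<open>ln \<bar>q\<bar>\<close> is subharmonic and \<open>ln \<bar>t\<bar>\<close> has \<open>C\<close>-mean \<open>0 = ln \<bar>\<i>\<bar>\<close>, so that Jensen's inequality
  gives, with \<open>I\<close> the \<open>C\<close>-mean of \<open>ln w\<close>,

  \<open>\<bar>p(\<i>)\<bar> exp I \<le> exp (\<integral> ln (\<bar>p\<bar> w) dC) \<le> \<integral> \<bar>p\<bar> w dC \<le> (1 / \<pi>) \<integral> \<bar>p(t)\<bar> / (1 + t\<^sup>2) dM(t)\<close>.

  The constant depends neither on \<open>q\<close> nor on \<open>m\<close>
  (\<open>cauchy_measure_ln_poly\<close>, \<open>laurent_evaluation_bound\<close>).

  By the Hahn-Banach theorem, the functional that maps \<open>p(t) / (1 + t\<^sup>2)\<close> to \<open>Re p(\<i>)\<close>, for real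
  Laurent polynomials \<open>p\<close>, extends to a bounded functional \<open>\<Lambda>\<close> on \<open>L\<^sup>1(M)\<close>. It annihilates every
  monomial \<open>t\<^sup>n\<close>, since \<open>t\<^sup>n (1 + t\<^sup>2)\<close> vanishes at \<open>\<i>\<close>, but not the function \<open>1 / (1 + t\<^sup>2)\<close>
  (\<open>laurent_annihilator\<close>). Adding a small multiple of \<open>\<Lambda>\<close> to \<open>M\<close> yields a positive measure,
  comparable to \<open>M\<close>, with the same moments of all integer orders and a different integral of
  \<open>1 / (1 + t\<^sup>2)\<close>; its cumulative distribution function is a second solution.

  The hypothesis speaks of the pointwise derivative of the distribution function of the absolutely
  continuous part; by Lebesgue's differentiation theorem it agrees with \<open>w\<close> almost everywhere
  (\<open>AE_cdf_has_derivative_density\<close>).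
\<close>

section \<open>Logarithmic integrals with respect to the Cauchy distribution\<close>

text \<open>
  The function \<open>Ln (1 + b u)\<close> is holomorphic on the closed unit disc, because \<open>1 + b u\<close> stays in the right
  half-plane there, and it vanishes at the centre. This is the real part of the mean value property.
\<close>

lemma circle_mean_ln_norm:
  assumes b: "cmod b < 1"
  shows "((\<lambda>s. ln (cmod (1 + b * exp (2 * of_real pi * \<i> * of_real s)))) has_integral 0) {0..1}"
proof -
  have pos: "Re (1 + b * u) > 0" if "cmod u \<le> 1" for u
  proof -
    have "cmod (b * u) < 1"
      using mult_mono[OF order_refl that, of "cmod b"] b by (simp add: norm_mult)
    then have "\<bar>Re (b * u)\<bar> < 1"
      using abs_Re_le_cmod le_less_trans by blast
    then show ?thesis by simp
  qed
  have "(\<lambda>u. Ln (1 + b * u)) holomorphic_on cball 0 1"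
    by (intro holomorphic_intros) (use pos in \<open>force simp: complex_nonpos_Reals_iff\<close>)
  from Cauchy_integral_circlepath_simple[OF this, of 0]
  have "((\<lambda>u. Ln (1 + b * u) / u) has_contour_integral 0) (circlepath 0 1)"
    by simp
  then have "((\<lambda>s. Ln (1 + b * circlepath 0 1 s) / circlepath 0 1 s *
      vector_derivative (circlepath 0 1) (at s within {0..1})) has_integral 0) {0..1}"
    by (simp add: has_contour_integral_def)
  then have "((\<lambda>s. 2 * of_real pi * \<i> * Ln (1 + b * exp (2 * of_real pi * \<i> * of_real s))) has_integral 0) {0..1}"
    by (rule has_integral_eq[rotated]) (simp add: vector_derivative_circlepath01, simp add: circlepath)
  from has_integral_mult_right[OF this, of "1 / (2 * of_real pi * \<i>)"]
  have "((\<lambda>s. Ln (1 + b * exp (2 * of_real pi * \<i> * of_real s))) has_integral 0) {0..1}"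
    by simp
  from has_integral_linear[OF this bounded_linear_Re]
  have "((\<lambda>s. Re (Ln (1 + b * exp (2 * of_real pi * \<i> * of_real s)))) has_integral 0) {0..1}"
    by (simp add: o_def)
  moreover have "Re (Ln (1 + b * exp (2 * of_real pi * \<i> * of_real s))) =
      ln (cmod (1 + b * exp (2 * of_real pi * \<i> * of_real s)))" for s
  proof -
    have "1 + b * exp (2 * of_real pi * \<i> * of_real s) \<noteq> 0"
      using pos[of "exp (2 * of_real pi * \<i> * of_real s)"] by fastforce
    then show ?thesis by simp
  qed
  ultimately show ?thesis by simp
qed

definition cauchy_measure :: "real measure" where
  "cauchy_measure = density lborel (\<lambda>t. ennreal (1 / (pi * (1 + t\<^sup>2))))"

lemma space_cauchy_measure [simp]: "space cauchy_measure = UNIV"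
  and sets_cauchy_measure [simp, measurable_cong]: "sets cauchy_measure = sets borel"
  by (simp_all add: cauchy_measure_def)

lemma has_bochner_integral_cauchy_measure_iff:
  assumes [measurable]: "f \<in> borel_measurable borel"
  shows "has_bochner_integral cauchy_measure f x \<longleftrightarrow>
    has_bochner_integral lborel (\<lambda>t. 1 / (pi * (1 + t\<^sup>2)) * (f t :: real)) x"
  unfolding cauchy_measure_def
  by (simp add: has_bochner_integral_iff integrable_density integral_density add_pos_nonneg)

lemma AE_cauchy_measure_iff: "(AE t in cauchy_measure. P t) \<longleftrightarrow> (AE t in lborel. P t)"
  unfolding cauchy_measure_def
  by (subst AE_density) (auto simp: add_pos_nonneg)

text \<open>
  The map \<open>t \<mapsto> 1/2 + arctan t / \<pi>\<close> is the cumulative distribution function of the Cauchy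
  distribution, so it transports that distribution to the uniform one on the unit interval.
\<close>

lemma cauchy_substitution:
  fixes f :: "real \<Rightarrow> real"
  assumes cont: "continuous_on {0..1} f" and int: "(f has_integral x) {0..1}"
  shows "has_bochner_integral cauchy_measure (\<lambda>t. f (1/2 + arctan t / pi)) x"
proof -
  let ?g = "\<lambda>t. 1/2 + arctan t / pi"
  have der: "(?g has_field_derivative 1 / (pi * (1 + t\<^sup>2))) (at t within UNIV)" for t
    by (auto intro!: derivative_eq_intros simp: field_simps add_nonneg_eq_0_iff)
  have inj: "inj_on ?g UNIV"
    by (auto simp: inj_on_def arctan_eq_iff)
  have range: "?g ` UNIV = {0<..<1}"
  proof (intro equalityI subsetI)
    fix s :: real assume "s \<in> ?g ` UNIV"
    then obtain t where s: "s = ?g t" by auto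
    have "- 1/2 < arctan t / pi" "arctan t / pi < 1/2"
      using arctan_bounded[of t] by (simp_all add: field_simps)
    then show "s \<in> {0<..<1}" unfolding s greaterThanLessThan_iff by linarith
  next
    fix s :: real assume s: "s \<in> {0<..<1}"
    have "arctan (tan (pi * (s - 1/2))) = pi * (s - 1/2)"
      using s by (intro arctan_tan) (auto simp: field_simps)
    then have "?g (tan (pi * (s - 1/2))) = s" by simp
    then show "s \<in> ?g ` UNIV" by (metis rangeI)
  qed
  have "f absolutely_integrable_on {0..1}"
    using cont by (rule absolutely_integrable_continuous_real)
  then have "f absolutely_integrable_on {0<..<1}"
    by (rule set_integrable_subset) auto
  moreover have "integral {0<..<1} f = x"
    using int by (simp add: integral_open_interval_real[symmetric] integral_unique)
  ultimately have *: "(\<lambda>t. \<bar>1 / (pi * (1 + t\<^sup>2))\<bar> * f (?g t)) absolutely_integrable_on UNIV"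
      "integral UNIV (\<lambda>t. \<bar>1 / (pi * (1 + t\<^sup>2))\<bar> * f (?g t)) = x"
    using has_absolute_integral_change_of_variables_1'[of UNIV ?g "\<lambda>t. 1 / (pi * (1 + t\<^sup>2))" f x, OF _ der inj]
    unfolding range by auto
  have abs: "\<bar>1 / (pi * (1 + t\<^sup>2))\<bar> = 1 / (pi * (1 + t\<^sup>2))" for t :: real
    by (simp add: add_nonneg_nonneg)
  have contg: "continuous_on UNIV (\<lambda>t. f (?g t))"
    by (rule continuous_on_compose2[OF cont]) (use range in \<open>auto intro!: continuous_intros\<close>)
  have [measurable]: "(\<lambda>t. f (?g t)) \<in> borel_measurable borel"
    using contg by (rule borel_measurable_continuous_onI)
  have "integrable lebesgue (\<lambda>t. 1 / (pi * (1 + t\<^sup>2)) * f (?g t))"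
    using *(1) unfolding abs set_integrable_def by simp
  then have "integrable lborel (\<lambda>t. 1 / (pi * (1 + t\<^sup>2)) * f (?g t))"
    by (subst (asm) integrable_completion) auto
  moreover from this have "integral\<^sup>L lborel (\<lambda>t. 1 / (pi * (1 + t\<^sup>2)) * f (?g t)) = x"
    using *(2) unfolding abs by (simp add: integral_lborel)
  ultimately show ?thesis
    by (subst has_bochner_integral_cauchy_measure_iff) (auto simp: has_bochner_integral_iff)
qed

lemma prob_space_cauchy_measure: "prob_space cauchy_measure"
proof
  have "((\<lambda>_ :: real. 1 :: real) has_integral 1) {0..1}"
    using has_integral_const_real[of "1::real" 0 1] by simp
  from cauchy_substitution[OF _ this]
  have 1: "has_bochner_integral cauchy_measure (\<lambda>_. 1 :: real) 1" by simp
  have "emeasure cauchy_measure (space cauchy_measure) = (\<integral>\<^sup>+_. ennreal 1 \<partial>cauchy_measure)"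
    by simp
  also have "\<dots> = ennreal 1"
    using 1 by (subst nn_integral_eq_integral) (auto simp: has_bochner_integral_iff)
  finally show "emeasure cauchy_measure (space cauchy_measure) = 1" by simp
qed

text \<open>
  Followed by the parametrisation of the unit circle, this map becomes the Cayley transform, which
  takes the real line to the circle and \<open>\<i>\<close> to the centre.
\<close>

lemma exp_arctan:
  "exp (2 * of_real pi * \<i> * of_real (1/2 + arctan t / pi)) = (of_real t - \<i>) / (of_real t + \<i>)"
proof -
  have nz: "complex_of_real t + \<i> \<noteq> 0" "1 - \<i> * complex_of_real t \<noteq> 0" "1 + \<i> * complex_of_real t \<noteq> 0"
    by (auto simp: complex_eq_iff)
  have "exp (2 * of_real pi * \<i> * of_real (1/2 + arctan t / pi)) = cis (pi + 2 * arctan t)"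
    by (simp add: cis_conv_exp distrib_left mult_ac)
  also have "\<dots> = - (cis (arctan t))\<^sup>2"
    by (simp only: cis_mult[symmetric] power2_eq_square mult_2 cis_pi) simp
  also have "cis (arctan t) = (1 + \<i> * t) / sqrt (1 + t\<^sup>2)"
    by (simp add: complex_eq_iff cos_arctan sin_arctan)
  also have "- ((1 + \<i> * t) / sqrt (1 + t\<^sup>2))\<^sup>2 = - ((1 + \<i> * t)\<^sup>2 / of_real (1 + t\<^sup>2))"
    by (simp add: power_divide flip: of_real_power)
  also have "of_real (1 + t\<^sup>2) = (1 + \<i> * t) * (1 - \<i> * complex_of_real t)"
    by (simp add: algebra_simps power2_eq_square)
  also have "- ((1 + \<i> * t)\<^sup>2 / ((1 + \<i> * t) * (1 - \<i> * complex_of_real t))) = (of_real t - \<i>) / (of_real t + \<i>)"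
    using nz by (simp add: divide_simps power2_eq_square) (simp add: algebra_simps)?
  finally show ?thesis .
qed

lemma measure_cauchy_measure_UNIV [simp]: "measure cauchy_measure UNIV = 1"
  using prob_space.prob_space[OF prob_space_cauchy_measure] by simp

text \<open>
  For \<open>b = (\<i> + a) / (\<i> - a)\<close> the Cayley transform turns \<open>1 + b u\<close> into the quotient
  \<open>2 \<i> (t - a) / ((\<i> - a) (t + \<i>))\<close>, and \<open>\<bar>b\<bar> < 1\<close> says that \<open>a\<close> lies in the open lower half-plane.
\<close>

lemma cauchy_measure_ln_quotient:
  assumes a: "Im a < 0"
  shows "has_bochner_integral cauchy_measure
    (\<lambda>t. ln (cmod (of_real t - a)) - ln (cmod (of_real t + \<i>))) (ln (cmod (\<i> - a)) - ln 2)"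
proof -
  define b where "b = (\<i> + a) / (\<i> - a)"
  have nz: "\<i> - a \<noteq> 0" "of_real t - a \<noteq> 0" "complex_of_real t + \<i> \<noteq> 0" for t
    using a by (auto simp: complex_eq_iff)
  have "cmod (\<i> + a) < cmod (\<i> - a)"
    using a by (simp add: cmod_def power2_eq_square algebra_simps)
  then have b: "cmod b < 1"
    using nz by (simp add: b_def norm_divide)
  have nz2: "1 + b * u \<noteq> 0" if "cmod u = 1" for u
  proof
    assume "1 + b * u = 0"
    then have "cmod (b * u) = cmod (- 1)" by (metis add_eq_0_iff)
    then show False using b that by (simp add: norm_mult)
  qed
  let ?f = "\<lambda>s. ln (cmod (1 + b * exp (2 * of_real pi * \<i> * of_real s)))"
  have "continuous_on {0..1} ?f"
    by (intro continuous_intros) (auto intro!: nz2)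
  from cauchy_substitution[OF this circle_mean_ln_norm[OF b]]
  have "has_bochner_integral cauchy_measure (\<lambda>t. ?f (1/2 + arctan t / pi)) 0" .
  moreover have "?f (1/2 + arctan t / pi) =
      ln (cmod (of_real t - a)) - ln (cmod (of_real t + \<i>)) + (ln 2 - ln (cmod (\<i> - a)))" for t
  proof -
    have "1 + b * ((of_real t - \<i>) / (of_real t + \<i>)) =
        2 * \<i> * (of_real t - a) / ((\<i> - a) * (of_real t + \<i>))"
      using nz by (simp add: b_def divide_simps) (simp add: algebra_simps)
    then show ?thesis
      unfolding exp_arctan using nz
      by (simp add: norm_mult norm_divide ln_mult ln_div)
  qed
  ultimately have *: "has_bochner_integral cauchy_measure (\<lambda>t. ln (cmod (of_real t - a)) - ln (cmod (of_real t + \<i>)) + (ln 2 - ln (cmod (\<i> - a)))) 0"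
    by simp
  interpret prob_space cauchy_measure by (rule prob_space_cauchy_measure)
  have "has_bochner_integral cauchy_measure (\<lambda>t. ln 2 - ln (cmod (\<i> - a))) (ln 2 - ln (cmod (\<i> - a)))"
    by (simp add: has_bochner_integral_iff prob_space)
  from has_bochner_integral_diff[OF * this] show ?thesis by simp
qed

text \<open>
  Apply the preceding formula at \<open>a = - R \<i>\<close> and let \<open>R\<close> tend to infinity: after adding the right
  constant, the integrands increase to \<open>ln \<bar>t + \<i>\<bar>\<close> and their means tend to \<open>ln 2\<close>. Monotone
  convergence yields the integrability as well.
\<close>

lemma cauchy_measure_ln_norm_plus_i:
  "has_bochner_integral cauchy_measure (\<lambda>t. ln (cmod (of_real t + \<i>))) (ln 2)"
proof -
  interpret prob_space cauchy_measure by (rule prob_space_cauchy_measure)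
  let ?R = "\<lambda>n. real (Suc n)"
  \<comment> \<open>minus the integrand for \<open>a = - R \<i>\<close>, normalised so that it converges as \<open>R\<close> grows\<close>
  define f where "f = (\<lambda>n t. ln (?R n) -
    (ln (cmod (complex_of_real t - (- (\<i> * of_real (?R n))))) - ln (cmod (complex_of_real t + \<i>))))"
  have f: "has_bochner_integral cauchy_measure (f n)
      (ln (?R n) - (ln (cmod (\<i> - (- (\<i> * of_real (?R n))))) - ln 2))" for n
    unfolding f_def
    by (rule has_bochner_integral_diff[OF _ cauchy_measure_ln_quotient])
       (use prob_space in \<open>simp_all add: has_bochner_integral_iff\<close>)
  have nz: "complex_of_real t + \<i> * of_real r \<noteq> 0" if "r > 0" for t r
    using that by (auto simp: complex_eq_iff)
  have f_eq: "f n t = ln (cmod (complex_of_real t + \<i>)) - ln (cmod (complex_of_real (t / ?R n) + \<i>))" for n t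
  proof -
    have "complex_of_real (t / ?R n) + \<i> = (complex_of_real t + \<i> * of_real (?R n)) / of_real (?R n)"
      by (simp add: field_simps del: of_nat_Suc)
    then have "cmod (complex_of_real (t / ?R n) + \<i>) = cmod (complex_of_real t + \<i> * of_real (?R n)) / ?R n"
      by (simp add: norm_divide del: of_nat_Suc)
    then show ?thesis
      using nz[of "?R n" t] by (simp add: f_def ln_div del: of_nat_Suc)
  qed
  have norm_eq: "cmod (complex_of_real t + \<i>) = sqrt (t\<^sup>2 + 1)" for t
    by (simp add: cmod_def)
  show ?thesis
  proof (rule has_bochner_integral_monotone_convergence[where f = f])
    show "integrable cauchy_measure (f n)" for n
      using f[of n] by (simp add: has_bochner_integral_iff)
    show "AE t in cauchy_measure. mono (\<lambda>n. f n t)"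
    proof (intro AE_I2 monoI)
      fix t and m n :: nat assume "m \<le> n"
      then have "\<bar>t\<bar> / ?R n \<le> \<bar>t\<bar> / ?R m"
        by (intro divide_left_mono) auto
      then have "(t / ?R n)\<^sup>2 \<le> (t / ?R m)\<^sup>2"
        unfolding abs_le_square_iff[symmetric] by simp
      then have "sqrt ((t / ?R n)\<^sup>2 + 1) \<le> sqrt ((t / ?R m)\<^sup>2 + 1)" by simp
      moreover have "0 < sqrt ((t / ?R n)\<^sup>2 + 1)" by (simp add: add_nonneg_pos)
      ultimately show "f m t \<le> f n t"
        unfolding f_eq norm_eq by (intro diff_left_mono ln_mono)
    qed
    show "AE t in cauchy_measure. (\<lambda>n. f n t) \<longlonglongrightarrow> ln (cmod (complex_of_real t + \<i>))"
    proof (intro AE_I2)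
      fix t :: real
      have "(\<lambda>n. t / ?R n) \<longlonglongrightarrow> 0"
        using LIMSEQ_Suc[OF lim_const_over_n[of t]] by simp
      then have "(\<lambda>n. f n t) \<longlonglongrightarrow> ln (cmod (complex_of_real t + \<i>)) - ln (cmod (complex_of_real 0 + \<i>))"
        unfolding f_eq by (intro tendsto_intros) auto
      then show "(\<lambda>n. f n t) \<longlonglongrightarrow> ln (cmod (complex_of_real t + \<i>))" by simp
    qed
    have "(\<lambda>n. - ln (1 + 1 / ?R n) + ln 2) \<longlonglongrightarrow> - ln (1 + 0) + ln 2"
      using LIMSEQ_Suc[OF lim_const_over_n[of 1]] by (intro tendsto_intros) auto
    moreover have "integral\<^sup>L cauchy_measure (f n) = - ln (1 + 1 / ?R n) + ln 2" for n
    proof -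
      have "\<i> - (- (\<i> * of_real (?R n))) = \<i> * of_real (1 + ?R n)"
        by (simp add: algebra_simps)
      then have "cmod (\<i> - (- (\<i> * of_real (?R n)))) = 1 + ?R n"
        by (simp only: norm_mult norm_of_real) simp
      moreover have "1 + 1 / ?R n = (1 + ?R n) / ?R n"
        by (simp add: field_simps)
      ultimately show ?thesis
        using f[of n] by (simp add: has_bochner_integral_iff ln_div del: of_nat_Suc)
    qed
    ultimately show "(\<lambda>n. integral\<^sup>L cauchy_measure (f n)) \<longlonglongrightarrow> ln 2" by simp
  qed (simp add: measurable_cong_sets[of cauchy_measure borel])
qed

lemma cauchy_measure_ln_lower_half_plane:
  assumes a: "Im a < 0"
  shows "has_bochner_integral cauchy_measure (\<lambda>t. ln (cmod (of_real t - a))) (ln (cmod (\<i> - a)))"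
  using has_bochner_integral_add[OF cauchy_measure_ln_quotient[OF a] cauchy_measure_ln_norm_plus_i]
  by simp

text \<open>
  A real \<open>a\<close> is approached vertically from below, along which \<open>\<bar>t - a\<bar>\<close> decreases for every \<open>t\<close>.
  The integrals have a finite limit because \<open>a \<noteq> \<i>\<close>, so monotone convergence applies.
\<close>

lemma cauchy_measure_ln_closed_lower_half_plane:
  assumes a: "Im a \<le> 0"
  shows "has_bochner_integral cauchy_measure (\<lambda>t. ln (cmod (of_real t - a))) (ln (cmod (\<i> - a)))"
proof -
  define c where "c = (\<lambda>n. a - \<i> / of_nat (Suc n))"
  have Im_c: "Im (c n) < 0" for n
    using le_less_trans[OF a, of "1 / real (Suc n)"] by (simp add: c_def Im_divide_of_nat del: of_nat_Suc)
  have c: "c \<longlonglongrightarrow> a"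
    using tendsto_diff[OF tendsto_const[of a] LIMSEQ_Suc[OF lim_const_over_n[of \<i>]]] by (simp add: c_def)
  have "has_bochner_integral cauchy_measure (\<lambda>t. - ln (cmod (of_real t - a))) (- ln (cmod (\<i> - a)))"
  proof (rule has_bochner_integral_monotone_convergence[where f = "\<lambda>n t. - ln (cmod (of_real t - c n))"])
    show "integrable cauchy_measure (\<lambda>t. - ln (cmod (of_real t - c n)))" for n
      using cauchy_measure_ln_lower_half_plane[OF Im_c[of n]] by (simp add: has_bochner_integral_iff)
    show "AE t in cauchy_measure. mono (\<lambda>n. - ln (cmod (of_real t - c n)))"
    proof (intro AE_I2 monoI)
      fix t and m n :: nat assume mn: "m \<le> n"
      have "Im (c m) \<le> Im (c n)"
        using mn by (simp add: c_def Im_divide_of_nat frac_le del: of_nat_Suc)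
      then have "\<bar>Im (c n)\<bar> \<le> \<bar>Im (c m)\<bar>"
        using Im_c[of n] Im_c[of m] by simp
      then have "(Im (c n))\<^sup>2 \<le> (Im (c m))\<^sup>2"
        by (simp add: abs_le_square_iff)
      moreover have "Re (c n) = Re (c m)" by (simp add: c_def Re_divide_of_nat del: of_nat_Suc)
      ultimately have "cmod (of_real t - c n) \<le> cmod (of_real t - c m)"
        by (simp add: cmod_def)
      moreover have "0 < cmod (of_real t - c n)"
        using Im_c[of n] by (auto simp: complex_eq_iff)
      ultimately show "- ln (cmod (of_real t - c m)) \<le> - ln (cmod (of_real t - c n))"
        by (simp add: ln_mono)
    qed
    have "AE t in lborel. t \<noteq> Re a" by (rule AE_lborel_singleton)
    then show "AE t in cauchy_measure. (\<lambda>n. - ln (cmod (of_real t - c n))) \<longlonglongrightarrow> - ln (cmod (of_real t - a))"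
      unfolding AE_cauchy_measure_iff
    proof eventually_elim
      case (elim t)
      then have "of_real t - a \<noteq> 0" by (auto simp: complex_eq_iff)
      then show ?case by (intro tendsto_intros c) simp
    qed
    have "\<i> - a \<noteq> 0" using a by (auto simp: complex_eq_iff)
    then have "(\<lambda>n. - ln (cmod (\<i> - c n))) \<longlonglongrightarrow> - ln (cmod (\<i> - a))"
      by (intro tendsto_intros c) simp
    then show "(\<lambda>n. \<integral>t. - ln (cmod (of_real t - c n)) \<partial>cauchy_measure) \<longlonglongrightarrow> - ln (cmod (\<i> - a))"
      using cauchy_measure_ln_lower_half_plane[OF Im_c] by (simp add: has_bochner_integral_iff)
  qed (simp add: measurable_cong_sets[of cauchy_measure borel])
  from has_bochner_integral_minus[OF this] show ?thesis by simp
qed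

text \<open>
  A zero in the upper half-plane can be reflected to the lower one: on the real line this does not
  change the modulus, and it only increases the modulus at \<open>\<i>\<close>.
\<close>

lemma cauchy_measure_ln_norm_diff:
  assumes "a \<noteq> \<i>"
  shows "integrable cauchy_measure (\<lambda>t. ln (cmod (of_real t - a)))"
    and "ln (cmod (\<i> - a)) \<le> (\<integral>t. ln (cmod (of_real t - a)) \<partial>cauchy_measure)"
proof -
  define c where "c = (if Im a \<le> 0 then a else cnj a)"
  have eq: "cmod (of_real t - a) = cmod (of_real t - c)" for t
    by (simp add: c_def cmod_def)
  have le: "cmod (\<i> - a) \<le> cmod (\<i> - c)"
    by (simp add: c_def cmod_def power2_eq_square algebra_simps)
  have "Im c \<le> 0" by (simp add: c_def)
  from cauchy_measure_ln_closed_lower_half_plane[OF this]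
  have *: "has_bochner_integral cauchy_measure (\<lambda>t. ln (cmod (of_real t - a))) (ln (cmod (\<i> - c)))"
    by (simp add: eq)
  then show "integrable cauchy_measure (\<lambda>t. ln (cmod (of_real t - a)))"
    by (simp add: has_bochner_integral_iff)
  show "ln (cmod (\<i> - a)) \<le> (\<integral>t. ln (cmod (of_real t - a)) \<partial>cauchy_measure)"
    using * le assms by (simp add: has_bochner_integral_iff ln_mono)
qed

lemma AE_poly_of_real_nonzero:
  fixes q :: "complex poly"
  assumes "q \<noteq> 0"
  shows "AE t in lborel. poly q (of_real t) \<noteq> 0"
proof -
  have "finite (of_real -` {z. poly q z = 0} :: real set)"
    using poly_roots_finite[OF assms] by (rule finite_vimageI) (auto simp: inj_on_def)
  then have "of_real -` {z. poly q z = 0} \<in> null_sets (lborel :: real measure)"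
    by (rule finite_imp_null_set_lborel)
  from AE_not_in[OF this] show ?thesis by simp
qed

text \<open>
  The submean value property of \<open>ln \<bar>q\<bar>\<close> at the point \<open>\<i>\<close>, obtained by splitting off linear factors.
\<close>

lemma cauchy_measure_ln_poly:
  fixes q :: "complex poly"
  assumes "poly q \<i> \<noteq> 0"
  shows "integrable cauchy_measure (\<lambda>t. ln (cmod (poly q (of_real t)))) \<and>
    ln (cmod (poly q \<i>)) \<le> (\<integral>t. ln (cmod (poly q (of_real t))) \<partial>cauchy_measure)"
  using assms
proof (induction "degree q" arbitrary: q rule: less_induct)
  case less
  interpret prob_space cauchy_measure by (rule prob_space_cauchy_measure)
  show ?case
  proof (cases "degree q = 0")
    case True
    then obtain c where "q = [:c:]" by (metis degree_eq_zeroE)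
    then show ?thesis by (simp add: prob_space)
  next
    case False
    then obtain a where "poly q a = 0"
      using Fundamental_Theorem_Algebra.fundamental_theorem_of_algebra[of q] by (auto simp: constant_degree)
    then obtain r where q: "q = [:- a, 1:] * r"
      by (auto simp: poly_eq_0_iff_dvd dvd_def)
    have r: "poly r \<i> \<noteq> 0" and a: "a \<noteq> \<i>"
      using less.prems by (auto simp: q)
    then have r0: "r \<noteq> 0" by auto
    then have "degree q = Suc (degree r)"
      unfolding q by (subst degree_mult_eq) auto
    then have IH: "integrable cauchy_measure (\<lambda>t. ln (cmod (poly r (of_real t))))"
        "ln (cmod (poly r \<i>)) \<le> (\<integral>t. ln (cmod (poly r (of_real t))) \<partial>cauchy_measure)"
      using less.hyps[of r] r by auto
    note lin = cauchy_measure_ln_norm_diff[OF a]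
    have AE: "AE t in cauchy_measure. ln (cmod (of_real t - a)) + ln (cmod (poly r (of_real t))) =
        ln (cmod (poly q (of_real t)))"
      unfolding AE_cauchy_measure_iff
      using AE_poly_of_real_nonzero[OF r0] AE_lborel_singleton[of "Re a"]
    proof eventually_elim
      case (elim t)
      then have "of_real t - a \<noteq> 0" by (auto simp: complex_eq_iff)
      moreover have "poly q (of_real t) = (of_real t - a) * poly r (of_real t)"
        by (simp add: q algebra_simps)
      ultimately show ?case using elim by (simp add: norm_mult ln_mult)
    qed
    have [measurable]: "(\<lambda>t. poly q (of_real t :: complex)) \<in> borel_measurable borel"
      by (intro borel_measurable_continuous_onI continuous_intros)
    have "has_bochner_integral cauchy_measure (\<lambda>t. ln (cmod (poly q (of_real t))))
       ((\<integral>t. ln (cmod (of_real t - a)) \<partial>cauchy_measure) + (\<integral>t. ln (cmod (poly r (of_real t))) \<partial>cauchy_measure))"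
      by (rule has_bochner_integralI_AE[OF _ _ AE])
         (use lin IH in \<open>simp_all add: has_bochner_integral_iff measurable_cong_sets[of cauchy_measure borel]\<close>)
    moreover have "poly q \<i> = (\<i> - a) * poly r \<i>"
      by (simp add: q algebra_simps)
    then have "ln (cmod (poly q \<i>)) = ln (cmod (\<i> - a)) + ln (cmod (poly r \<i>))"
      using r a by (simp add: norm_mult ln_mult)
    ultimately show ?thesis
      using lin IH by (simp add: has_bochner_integral_iff)
  qed
qed

text \<open>
  Jensen's inequality for the exponential function and the random variable
  \<open>ln (\<bar>q(t)\<bar> \<bar>t\<bar>\<^sup>-\<^sup>m w(t))\<close>. The factor \<open>\<bar>t\<bar>\<^sup>-\<^sup>m\<close> does not contribute to the left-hand side, since
  \<open>ln \<bar>t\<bar>\<close> has mean zero; hence the bound is uniform in \<open>m\<close>.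
\<close>

lemma laurent_polynomial_at_i_le_cauchy_integral:
  fixes q :: "complex poly" and w :: "real \<Rightarrow> real"
  assumes [measurable]: "w \<in> borel_measurable borel"
    and pos: "AE t in lborel. w t > 0"
    and log: "integrable cauchy_measure (\<lambda>t. ln (w t))"
    and int: "integrable cauchy_measure (\<lambda>t. cmod (poly q (of_real t)) / \<bar>t\<bar> ^ m * w t)"
  shows "exp (\<integral>t. ln (w t) \<partial>cauchy_measure) * cmod (poly q \<i>) \<le>
    (\<integral>t. cmod (poly q (of_real t)) / \<bar>t\<bar> ^ m * w t \<partial>cauchy_measure)"
proof (cases "poly q \<i> = 0")
  case True
  have "0 \<le> (\<integral>t. cmod (poly q (of_real t)) / \<bar>t\<bar> ^ m * w t \<partial>cauchy_measure)"
    by (rule integral_nonneg_AE) (use pos in \<open>auto simp: AE_cauchy_measure_iff\<close>)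
  then show ?thesis using True by simp
next
  case False
  interpret prob_space cauchy_measure by (rule prob_space_cauchy_measure)
  let ?X = "\<lambda>t. ln (cmod (poly q (of_real t))) - real m * ln \<bar>t\<bar> + ln (w t)"
  have ln_abs: "has_bochner_integral cauchy_measure (\<lambda>t. ln \<bar>t\<bar>) 0"
    using cauchy_measure_ln_closed_lower_half_plane[of 0] by simp
  note q = cauchy_measure_ln_poly[OF False]
  have X: "integrable cauchy_measure ?X"
    using q log ln_abs by (auto simp: has_bochner_integral_iff)
  have eX: "expectation ?X = expectation (\<lambda>t. ln (cmod (poly q (of_real t)))) + expectation (\<lambda>t. ln (w t))"
    using q log ln_abs by (simp add: has_bochner_integral_iff)
  from False have "q \<noteq> 0" by auto
  have exp_X: "AE t in cauchy_measure. exp (?X t) = cmod (poly q (of_real t)) / \<bar>t\<bar> ^ m * w t"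
    unfolding AE_cauchy_measure_iff
    using AE_poly_of_real_nonzero[OF \<open>q \<noteq> 0\<close>] AE_lborel_singleton[of 0] pos
    by eventually_elim (simp add: exp_add exp_diff exp_of_nat_mult)
  have int_exp: "integrable cauchy_measure (\<lambda>t. exp (?X t))"
    by (subst integrable_cong_AE[OF _ _ exp_X]) (use int X in auto)
  have "exp (expectation (\<lambda>t. ln (w t))) * cmod (poly q \<i>) =
      exp (ln (cmod (poly q \<i>)) + expectation (\<lambda>t. ln (w t)))"
    using False by (simp add: exp_add)
  also have "\<dots> \<le> exp (expectation ?X)"
    using q by (simp add: eX)
  also have "\<dots> \<le> expectation (\<lambda>t. exp (?X t))"
    using X int_exp exp_convex by (intro jensens_inequality[where I = UNIV]) auto
  also have "\<dots> = (\<integral>t. cmod (poly q (of_real t)) / \<bar>t\<bar> ^ m * w t \<partial>cauchy_measure)"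
    using exp_X int_exp int by (intro integral_cong_AE) auto
  finally show ?thesis .
qed

section \<open>The Hahn-Banach theorem for spaces of real functions\<close>

text \<open>
  The space \<open>X\<close> consists of honest functions rather than classes modulo null sets, so that the theorem
  applies to integrable functions; the seminorm \<open>\<integral> \<bar>f\<bar>\<close> is sublinear on them.
\<close>

locale sublinear_on =
  fixes X :: "('a \<Rightarrow> real) set" and P :: "('a \<Rightarrow> real) \<Rightarrow> real"
  assumes zero_mem: "(\<lambda>x. 0) \<in> X"
    and add_mem: "f \<in> X \<Longrightarrow> g \<in> X \<Longrightarrow> (\<lambda>x. f x + g x) \<in> X"
    and scale_mem: "f \<in> X \<Longrightarrow> (\<lambda>x. c * f x) \<in> X"
    and P_add: "f \<in> X \<Longrightarrow> g \<in> X \<Longrightarrow> P (\<lambda>x. f x + g x) \<le> P f + P g"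
    and P_scale: "f \<in> X \<Longrightarrow> c > 0 \<Longrightarrow> P (\<lambda>x. c * f x) = c * P f"
begin

text \<open>
  A partially defined linear functional dominated by \<open>P\<close>, given by its graph. The graph is not
  required to be single-valued: domination enforces this.
\<close>

definition dominated_relation :: "(('a \<Rightarrow> real) \<times> real) set \<Rightarrow> bool" where
  "dominated_relation G \<longleftrightarrow> G \<subseteq> X \<times> UNIV \<and> (\<lambda>x. 0, 0) \<in> G \<and>
    (\<forall>f r g s. (f, r) \<in> G \<longrightarrow> (g, s) \<in> G \<longrightarrow> (\<lambda>x. f x + g x, r + s) \<in> G) \<and>
    (\<forall>f r c. (f, r) \<in> G \<longrightarrow> (\<lambda>x. c * f x, c * r) \<in> G) \<and>
    (\<forall>f r. (f, r) \<in> G \<longrightarrow> r \<le> P f)"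

lemma
  assumes "dominated_relation G"
  shows dominated_mem: "(f, r) \<in> G \<Longrightarrow> f \<in> X"
    and dominated_zero: "(\<lambda>x. 0, 0) \<in> G"
    and dominated_add: "(f, r) \<in> G \<Longrightarrow> (g, s) \<in> G \<Longrightarrow> (\<lambda>x. f x + g x, r + s) \<in> G"
    and dominated_scale: "(f, r) \<in> G \<Longrightarrow> (\<lambda>x. c * f x, c * r) \<in> G"
    and dominated_le: "(f, r) \<in> G \<Longrightarrow> r \<le> P f"
  using assms unfolding dominated_relation_def by auto

lemma P_zero: "P (\<lambda>x. 0) = 0"
  using P_scale[OF zero_mem, of 2] by simp

text \<open>
  Two values at the same \<open>f\<close> differ by a value at the zero function, and those are bounded above by
  \<open>P 0 = 0\<close>.
\<close>

lemma dominated_unique: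
  assumes G: "dominated_relation G" and f: "(f, r) \<in> G" "(f, s) \<in> G"
  shows "r = s"
proof -
  have "u \<le> v" if "(f, u) \<in> G" "(f, v) \<in> G" for u v
  proof -
    have "(\<lambda>x. f x + -1 * f x, u + -1 * v) \<in> G"
      by (intro dominated_add[OF G] dominated_scale[OF G] that)
    from dominated_le[OF G this] show ?thesis by (simp add: P_zero)
  qed
  from this[OF f] this[OF f(2,1)] show ?thesis by simp
qed

text \<open>
  The value \<open>c\<close> at \<open>h\<close> has to satisfy \<open>r - P (f - h) \<le> c \<le> P (g + h) - s\<close> for all \<open>(f, r)\<close> and
  \<open>(g, s)\<close> in the graph. Subadditivity of \<open>P\<close> makes every lower bound at most every upper bound, so
  that the supremum \<open>Sup L\<close> of the lower bounds is a possible choice.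
\<close>

lemma dominated_extend:
  assumes G: "dominated_relation G" and h: "h \<in> X"
  obtains c where "dominated_relation {(\<lambda>x. f x + a * h x, r + a * c) | f r a. (f, r) \<in> G}"
proof -
  define L where "L = {r - P (\<lambda>x. f x + -1 * h x) | f r. (f, r) \<in> G}"
  have upper: "l \<le> P (\<lambda>x. g x + h x) - s" if l: "l \<in> L" and g: "(g, s) \<in> G" for l g s
  proof -
    obtain f r where f: "(f, r) \<in> G" and l_eq: "l = r - P (\<lambda>x. f x + -1 * h x)"
      using l by (auto simp: L_def)
    note fX = dominated_mem[OF G f] and gX = dominated_mem[OF G g]
    have "r + s \<le> P (\<lambda>x. f x + g x)"
      by (rule dominated_le[OF G dominated_add[OF G f g]])
    also have "(\<lambda>x. f x + g x) = (\<lambda>x. (f x + -1 * h x) + (g x + h x))"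
      by auto
    also have "P \<dots> \<le> P (\<lambda>x. f x + -1 * h x) + P (\<lambda>x. g x + h x)"
      by (intro P_add add_mem fX gX h scale_mem[OF h, of "-1"])
    finally show ?thesis by (simp add: l_eq)
  qed
  have "L \<noteq> {}"
    using dominated_zero[OF G] by (auto simp: L_def)
  moreover have bdd: "bdd_above L"
    using upper[OF _ dominated_zero[OF G]] by (intro bdd_aboveI) auto
  ultimately have c_upper: "Sup L \<le> P (\<lambda>x. g x + h x) - s" if "(g, s) \<in> G" for g s
    using upper[OF _ that] by (intro cSup_least) auto
  have c_lower: "r - P (\<lambda>x. f x + -1 * h x) \<le> Sup L" if "(f, r) \<in> G" for f r
    using that by (intro cSup_upper bdd) (auto simp: L_def)
  define c where "c = Sup L"
  let ?H = "{(\<lambda>x. f x + a * h x, r + a * c) | f r a. (f, r) \<in> G}"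
  have le: "r + a * c \<le> P (\<lambda>x. f x + a * h x)" if f: "(f, r) \<in> G" for f r a
  proof -
    consider "a = 0" | "a > 0" | "a < 0" by linarith
    then show ?thesis
    proof cases
      case 1
      then show ?thesis using dominated_le[OF G f] by simp
    next
      case 2
      have g: "(\<lambda>x. (1/a) * f x, (1/a) * r) \<in> G" by (rule dominated_scale[OF G f])
      then have "a * c \<le> a * (P (\<lambda>x. (1/a) * f x + h x) - (1/a) * r)"
        using c_upper[OF g] 2 unfolding c_def by (intro mult_left_mono) auto
      also have "\<dots> = P (\<lambda>x. a * ((1/a) * f x + h x)) - r"
        using 2 by (subst P_scale) (auto simp: algebra_simps intro!: add_mem h dominated_mem[OF G g, simplified])
      also have "(\<lambda>x. a * ((1/a) * f x + h x)) = (\<lambda>x. f x + a * h x)"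
        using 2 by (auto simp: field_simps)
      finally show ?thesis by simp
    next
      case 3
      define b where "b = - a"
      have b: "b > 0" and a: "a = - b" using 3 by (auto simp: b_def)
      have g: "(\<lambda>x. (1/b) * f x, (1/b) * r) \<in> G" by (rule dominated_scale[OF G f])
      have "b * ((1/b) * r - P (\<lambda>x. (1/b) * f x + -1 * h x)) \<le> b * c"
        using c_lower[OF g] b unfolding c_def by (intro mult_left_mono) auto
      moreover have "b * P (\<lambda>x. (1/b) * f x + -1 * h x) = P (\<lambda>x. b * ((1/b) * f x + -1 * h x))"
        by (rule P_scale[symmetric]) (intro add_mem dominated_mem[OF G g] scale_mem h b)+
      moreover have "(\<lambda>x. b * ((1/b) * f x + -1 * h x)) = (\<lambda>x. f x + a * h x)"
        using b by (auto simp: a field_simps)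
      ultimately show ?thesis using b by (simp add: algebra_simps a)
    qed
  qed
  have "dominated_relation ?H"
    unfolding dominated_relation_def
  proof (intro conjI allI impI)
    show "?H \<subseteq> X \<times> UNIV"
      by (auto intro!: add_mem scale_mem h dest: dominated_mem[OF G])
    show "(\<lambda>x. 0, 0) \<in> ?H"
      using dominated_zero[OF G] by (intro CollectI exI[of _ "\<lambda>x. 0"] exI[of _ 0]) auto
  next
    fix f r g s assume "(f, r) \<in> ?H" "(g, s) \<in> ?H"
    then obtain f1 r1 a g1 s1 b where
      f: "f = (\<lambda>x. f1 x + a * h x)" "r = r1 + a * c" "(f1, r1) \<in> G" and
      g: "g = (\<lambda>x. g1 x + b * h x)" "s = s1 + b * c" "(g1, s1) \<in> G" by auto
    show "(\<lambda>x. f x + g x, r + s) \<in> ?H"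
      using dominated_add[OF G f(3) g(3)] f(1,2) g(1,2)
      by (intro CollectI exI[of _ "\<lambda>x. f1 x + g1 x"] exI[of _ "r1 + s1"] exI[of _ "a + b"])
         (auto simp: algebra_simps)
  next
    fix f r k assume "(f, r) \<in> ?H"
    then obtain f1 r1 a where f: "f = (\<lambda>x. f1 x + a * h x)" "r = r1 + a * c" "(f1, r1) \<in> G" by auto
    show "(\<lambda>x. k * f x, k * r) \<in> ?H"
      using dominated_scale[OF G f(3), of k] f(1,2)
      by (intro CollectI exI[of _ "\<lambda>x. k * f1 x"] exI[of _ "k * r1"] exI[of _ "k * a"])
         (auto simp: algebra_simps)
  next
    fix f r assume "(f, r) \<in> ?H"
    then show "r \<le> P f" using le by auto
  qed
  with that show thesis by blast
qed

text \<open>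
  A maximal dominated extension exists by Zorn's lemma, and the one-step extension shows that it is
  defined on all of \<open>X\<close>.
\<close>

theorem hahn_banach:
  assumes G: "dominated_relation G"
  obtains \<Lambda> where "\<And>f r. (f, r) \<in> G \<Longrightarrow> \<Lambda> f = r"
    and "\<And>f g. f \<in> X \<Longrightarrow> g \<in> X \<Longrightarrow> \<Lambda> (\<lambda>x. f x + g x) = \<Lambda> f + \<Lambda> g"
    and "\<And>f c. f \<in> X \<Longrightarrow> \<Lambda> (\<lambda>x. c * f x) = c * \<Lambda> f"
    and "\<And>f. f \<in> X \<Longrightarrow> \<Lambda> f \<le> P f"
proof -
  let ?A = "{H. G \<subseteq> H \<and> dominated_relation H}"
  have "\<exists>M\<in>?A. \<forall>H\<in>?A. M \<subseteq> H \<longrightarrow> H = M"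
  proof (rule subset_Zorn_nonempty)
    show "?A \<noteq> {}" using G by auto
    fix C assume C: "C \<noteq> {}" "subset.chain ?A C"
    have dom: "dominated_relation H" and sub: "G \<subseteq> H" if "H \<in> C" for H
      using C(2) that by (auto simp: subset.chain_def)
    have "dominated_relation (\<Union>C)"
      unfolding dominated_relation_def
    proof (intro conjI allI impI)
      show "\<Union>C \<subseteq> X \<times> UNIV" using dominated_mem[OF dom] by auto
      show "(\<lambda>x. 0, 0) \<in> \<Union>C" using C(1) dominated_zero[OF dom] by blast
    next
      fix f r g s assume "(f, r) \<in> \<Union>C" "(g, s) \<in> \<Union>C"
      then obtain H1 H2 where H: "H1 \<in> C" "(f, r) \<in> H1" "H2 \<in> C" "(g, s) \<in> H2" by auto
      have "H1 \<subseteq> H2 \<or> H2 \<subseteq> H1" using C(2) H unfolding subset_chain_def by blast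
      then obtain H where "H \<in> C" "(f, r) \<in> H" "(g, s) \<in> H" using H by auto
      then show "(\<lambda>x. f x + g x, r + s) \<in> \<Union>C" using dominated_add[OF dom] by blast
    next
      fix f r c assume "(f, r) \<in> \<Union>C"
      then show "(\<lambda>x. c * f x, c * r) \<in> \<Union>C" using dominated_scale[OF dom] by blast
    next
      fix f r assume "(f, r) \<in> \<Union>C"
      then show "r \<le> P f" using dominated_le[OF dom] by blast
    qed
    moreover have "G \<subseteq> \<Union>C" using C(1) sub by blast
    ultimately show "\<Union>C \<in> ?A" by blast
  qed
  then obtain M where M: "dominated_relation M" "G \<subseteq> M"
    and max: "\<And>H. dominated_relation H \<Longrightarrow> G \<subseteq> H \<Longrightarrow> M \<subseteq> H \<Longrightarrow> H = M" by auto
  have total: "\<exists>r. (h, r) \<in> M" if h: "h \<in> X" for h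
  proof -
    obtain c where H: "dominated_relation {(\<lambda>x. f x + a * h x, r + a * c) | f r a. (f, r) \<in> M}" (is "dominated_relation ?H")
      using dominated_extend[OF M(1) h] by blast
    have "M \<subseteq> ?H"
    proof
      fix p assume p: "p \<in> M"
      obtain f r where "p = (f, r)" by (cases p)
      with p show "p \<in> ?H"
        by (intro CollectI exI[of _ f] exI[of _ r] exI[of _ 0]) auto
    qed
    with max[OF H] M(2) have "?H = M" by blast
    moreover have "(h, c) \<in> ?H"
      using dominated_zero[OF M(1)] by (intro CollectI exI[of _ "\<lambda>x. 0"] exI[of _ 0] exI[of _ 1]) auto
    ultimately show ?thesis by blast
  qed
  define \<Lambda> where "\<Lambda> = (\<lambda>f. SOME r. (f, r) \<in> M)"
  have \<Lambda>: "(f, \<Lambda> f) \<in> M" if "f \<in> X" for f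
    using total[OF that] unfolding \<Lambda>_def by (rule someI_ex)
  have \<Lambda>_eq: "\<Lambda> f = r" if "(f, r) \<in> M" for f r
    using dominated_unique[OF M(1) \<Lambda>[OF dominated_mem[OF M(1) that]] that] .
  show thesis
  proof
    show "\<Lambda> f = r" if "(f, r) \<in> G" for f r using \<Lambda>_eq M(2) that by blast
    show "\<Lambda> (\<lambda>x. f x + g x) = \<Lambda> f + \<Lambda> g" if "f \<in> X" "g \<in> X" for f g
      by (intro \<Lambda>_eq dominated_add[OF M(1)] \<Lambda> that)
    show "\<Lambda> (\<lambda>x. c * f x) = c * \<Lambda> f" if "f \<in> X" for f c
      by (intro \<Lambda>_eq dominated_scale[OF M(1)] \<Lambda> that)
    show "\<Lambda> f \<le> P f" if "f \<in> X" for f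
      by (rule dominated_le[OF M(1) \<Lambda>[OF that]])
  qed
qed

end


section \<open>Perturbing a measure by a bounded functional on integrable functions\<close>

locale bounded_L1_functional = finite_measure M for M :: "'a measure" +
  fixes \<Lambda> :: "('a \<Rightarrow> real) \<Rightarrow> real" and K :: real
  assumes L_add: "integrable M f \<Longrightarrow> integrable M g \<Longrightarrow> \<Lambda> (\<lambda>x. f x + g x) = \<Lambda> f + \<Lambda> g"
    and L_scale: "integrable M f \<Longrightarrow> \<Lambda> (\<lambda>x. c * f x) = c * \<Lambda> f"
    and L_bound: "integrable M f \<Longrightarrow> \<bar>\<Lambda> f\<bar> \<le> K * (\<integral>x. \<bar>f x\<bar> \<partial>M)"
    and K_pos: "K > 0"
begin

lemma diff: "integrable M f \<Longrightarrow> integrable M g \<Longrightarrow> \<Lambda> (\<lambda>x. f x - g x) = \<Lambda> f - \<Lambda> g"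
  using L_add[of f "\<lambda>x. -1 * g x"] L_scale[of g "-1"] by simp

lemma cong_AE:
  assumes "integrable M f" "integrable M g" "AE x in M. f x = g x"
  shows "\<Lambda> f = \<Lambda> g"
proof -
  have "(\<integral>x. \<bar>f x - g x\<bar> \<partial>M) = (\<integral>x. 0 \<partial>M)"
    using assms by (intro integral_cong_AE) auto
  then have "\<bar>\<Lambda> (\<lambda>x. f x - g x)\<bar> \<le> 0"
    using L_bound[of "\<lambda>x. f x - g x"] assms by simp
  then show ?thesis using assms by (simp add: diff)
qed

text \<open>
  Dominated convergence in \<open>L\<^sup>1\<close>. Applied to indicators it makes the perturbed set function countably
  additive.
\<close>

lemma dominated_limit:
  assumes s: "\<And>i. integrable M (s i)" and f: "integrable M f" and g: "integrable M g"
    and lim: "AE x in M. (\<lambda>i. s i x) \<longlonglongrightarrow> f x"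
    and dom: "\<And>i. AE x in M. \<bar>s i x\<bar> \<le> g x"
  shows "(\<lambda>i. \<Lambda> (s i)) \<longlonglongrightarrow> \<Lambda> f"
proof -
  have "(\<lambda>i. \<integral>x. \<bar>s i x - f x\<bar> \<partial>M) \<longlonglongrightarrow> (\<integral>x. 0 \<partial>M)"
  proof (rule integral_dominated_convergence[where w = "\<lambda>x. g x + \<bar>f x\<bar>"])
    show "AE x in M. (\<lambda>i. \<bar>s i x - f x\<bar>) \<longlonglongrightarrow> 0"
      using lim by eventually_elim (simp add: LIM_zero tendsto_rabs_zero)
    show "AE x in M. norm \<bar>s i x - f x\<bar> \<le> g x + \<bar>f x\<bar>" for i
      using dom[of i] by eventually_elim auto
  qed (use s f g in auto)
  then have "(\<lambda>i. K * (\<integral>x. \<bar>s i x - f x\<bar> \<partial>M)) \<longlonglongrightarrow> 0"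
    using tendsto_mult_right_zero by fastforce
  then have "(\<lambda>i. \<Lambda> (s i) - \<Lambda> f) \<longlonglongrightarrow> 0"
  proof (rule Lim_null_comparison[rotated])
    show "\<forall>\<^sub>F i in sequentially. norm (\<Lambda> (s i) - \<Lambda> f) \<le> K * (\<integral>x. \<bar>s i x - f x\<bar> \<partial>M)"
      using L_bound[of "\<lambda>x. s _ x - f x"] s f by (simp add: diff)
  qed
  then show ?thesis by (rule LIM_zero_cancel)
qed

text \<open>
  The weight \<open>1 / (2 K)\<close> keeps the perturbation below half of \<open>M\<close>, whence the perturbed measure is
  positive, and comparable to \<open>M\<close> from both sides.
\<close>

definition perturbed_value :: "'a set \<Rightarrow> real" where
  "perturbed_value A = measure M A + \<Lambda> (indicator A) / (2 * K)"

definition perturbed :: "'a measure" where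
  "perturbed = measure_of (space M) (sets M) (\<lambda>A. ennreal (perturbed_value A))"

lemma space_perturbed [simp]: "space perturbed = space M"
  and sets_perturbed [simp, measurable_cong]: "sets perturbed = sets M"
  by (simp_all add: perturbed_def)

lemma perturbed_value_bounds:
  assumes "A \<in> sets M"
  shows "measure M A / 2 \<le> perturbed_value A" "perturbed_value A \<le> 2 * measure M A"
proof -
  have ind: "integrable M (indicator A :: 'a \<Rightarrow> real)"
    using assms by (simp add: less_top[symmetric])
  have "(\<integral>x. \<bar>indicator A x :: real\<bar> \<partial>M) = measure M A"
    using assms by simp
  then have "\<bar>\<Lambda> (indicator A)\<bar> \<le> K * measure M A"
    using L_bound[OF ind] by simp
  then have "\<bar>\<Lambda> (indicator A) / (2 * K)\<bar> \<le> measure M A / 2"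
    using K_pos by (simp add: abs_divide field_simps)
  then show "measure M A / 2 \<le> perturbed_value A" "perturbed_value A \<le> 2 * measure M A"
    unfolding perturbed_value_def using measure_nonneg[of M A] by linarith+
qed

lemma perturbed_value_sums:
  assumes A: "range A \<subseteq> sets M" "disjoint_family A"
  shows "(\<lambda>i::nat. perturbed_value (A i)) sums perturbed_value (\<Union>i. A i)"
proof -
  have Ai: "A i \<in> sets M" for i using A by auto
  have ind: "integrable M (indicator B :: 'a \<Rightarrow> real)" if "B \<in> sets M" for B
    using that by (simp add: less_top[symmetric])
  have sum: "(\<lambda>x. \<Sum>i<n. indicator (A i) x :: real) = indicator (\<Union>i<n. A i)" for n
    using A(2) by (intro ext indicator_UN_disjoint[symmetric]) (auto simp: disjoint_family_on_def)
  have \<Lambda>_sum: "\<Lambda> (indicator (\<Union>i<n. A i)) = (\<Sum>i<n. \<Lambda> (indicator (A i)))" for n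
  proof (induction n)
    case 0
    show ?case using L_scale[of "\<lambda>x. 0" 0] by (simp add: indicator_def[abs_def])
  next
    case (Suc n)
    have "\<Lambda> (indicator (\<Union>i<Suc n. A i)) = \<Lambda> (\<lambda>x. indicator (\<Union>i<n. A i) x + indicator (A n) x)"
      unfolding sum[symmetric] by simp
    also have "\<dots> = (\<Sum>i<Suc n. \<Lambda> (indicator (A i)))"
      using Ai by (subst L_add) (auto intro!: ind simp: Suc)
    finally show ?case .
  qed
  have "(\<lambda>n. \<Lambda> (indicator (\<Union>i<n. A i))) \<longlonglongrightarrow> \<Lambda> (indicator (\<Union>i. A i))"
  proof (rule dominated_limit[where g = "\<lambda>x. 1"])
    show "AE x in M. (\<lambda>n. indicator (\<Union>i<n. A i) x :: real) \<longlonglongrightarrow> indicator (\<Union>i. A i) x"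
      by (intro AE_I2 LIMSEQ_indicator_UN)
  qed (use Ai in \<open>auto intro!: ind simp: indicator_def\<close>)
  then have "(\<lambda>i. \<Lambda> (indicator (A i))) sums \<Lambda> (indicator (\<Union>i. A i))"
    by (simp add: \<Lambda>_sum sums_def)
  from sums_add[OF finite_measure_UNION[OF A] sums_divide[OF this, of "2 * K"]]
  show ?thesis by (simp add: perturbed_value_def)
qed

lemma emeasure_perturbed:
  assumes "A \<in> sets M"
  shows "emeasure perturbed A = ennreal (perturbed_value A)"
proof (rule emeasure_measure_of[OF perturbed_def])
  have nonneg: "0 \<le> perturbed_value A" if "A \<in> sets M" for A
    using order_trans[OF _ perturbed_value_bounds(1)[OF that]] by simp
  show "positive (sets perturbed) (\<lambda>A. ennreal (perturbed_value A))"
    using perturbed_value_bounds[of "{}"] by (simp add: positive_def)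
  show "countably_additive (sets perturbed) (\<lambda>A. ennreal (perturbed_value A))"
  proof (rule countably_additiveI)
    fix A :: "nat \<Rightarrow> 'a set" assume A: "range A \<subseteq> sets perturbed" "disjoint_family A"
    then have "(\<lambda>i. perturbed_value (A i)) sums perturbed_value (\<Union>i. A i)"
      by (intro perturbed_value_sums) auto
    then show "(\<Sum>i. ennreal (perturbed_value (A i))) = ennreal (perturbed_value (\<Union>i. A i))"
      using A by (subst suminf_ennreal2) (auto intro!: nonneg simp: sums_iff)
  qed
qed (use assms sets.space_closed in auto)

lemma emeasure_perturbed_le:
  assumes "A \<in> sets M"
  shows "emeasure perturbed A \<le> 2 * emeasure M A" and "emeasure M A \<le> 2 * emeasure perturbed A"
proof -
  have 0: "0 \<le> perturbed_value A"
    using order_trans[OF _ perturbed_value_bounds(1)[OF assms]] by simp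
  have eq: "2 * ennreal x = ennreal (2 * x)" if "0 \<le> x" for x
    using that by (simp add: ennreal_mult)
  show "emeasure perturbed A \<le> 2 * emeasure M A" and "emeasure M A \<le> 2 * emeasure perturbed A"
    using perturbed_value_bounds[OF assms] 0
    by (simp_all add: emeasure_perturbed[OF assms] emeasure_eq_measure eq ennreal_leI)
qed

lemma finite_measure_perturbed: "finite_measure perturbed"
  by (intro finite_measureI) (simp add: emeasure_perturbed)

lemma AE_perturbed: "(AE x in M. Q x) \<Longrightarrow> (AE x in perturbed. Q x)"
proof -
  assume "AE x in M. Q x"
  then obtain N where N: "N \<in> null_sets M" "{x\<in>space M. \<not> Q x} \<subseteq> N"
    by (auto simp: eventually_ae_filter)
  then have "N \<in> null_sets perturbed"
    using emeasure_perturbed_le(1)[of N] by (auto simp: null_sets_def)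
  then show ?thesis using N(2) by (auto simp: eventually_ae_filter)
qed

lemma integrable_perturbed:
  fixes f :: "'a \<Rightarrow> real"
  assumes f: "integrable M f"
  shows "integrable perturbed f"
proof (rule integrableI_bounded)
  have "(\<integral>\<^sup>+ x. ennreal (norm (f x)) \<partial>perturbed) \<le> (\<integral>\<^sup>+ x. ennreal (norm (f x)) \<partial>scale_measure 2 M)"
    by (rule nn_integral_mono_measure) (auto simp: le_measure emeasure_perturbed_le)
  also have "\<dots> = 2 * (\<integral>\<^sup>+ x. ennreal (norm (f x)) \<partial>M)"
    using f by (intro nn_integral_scale_measure) auto
  also have "\<dots> < \<infinity>"
    using f by (auto simp: integrable_iff_bounded ennreal_mult_less_top)
  finally show "(\<integral>\<^sup>+ x. ennreal (norm (f x)) \<partial>perturbed) < \<infinity>" .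
qed (use f in auto)

lemma integral_perturbed:
  fixes f :: "'a \<Rightarrow> real"
  assumes "integrable M f"
  shows "(\<integral>x. f x \<partial>perturbed) = (\<integral>x. f x \<partial>M) + \<Lambda> f / (2 * K)"
  using assms
proof (induction rule: integrable_induct)
  case (base A c)
  have ind: "integrable M (indicator A :: 'a \<Rightarrow> real)"
    using base by (simp add: less_top[symmetric])
  have "measure perturbed A = perturbed_value A"
    using perturbed_value_bounds[OF base(1)] order_trans[of 0 "measure M A / 2"]
    by (simp add: measure_def emeasure_perturbed[OF base(1)])
  then have "(\<integral>x. indicator A x \<partial>perturbed) = perturbed_value A"
    using base by simp
  moreover have "\<Lambda> (\<lambda>x. indicator A x *\<^sub>R c) = c * \<Lambda> (indicator A)"
    using L_scale[OF ind, of c] by (simp add: mult.commute)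
  ultimately show ?case
    using base(1) by (simp add: perturbed_value_def algebra_simps)
next
  case (add f g)
  then show ?case
    by (simp add: integrable_perturbed L_add add_divide_distrib)
next
  case (lim f s)
  have dom: "AE x in M. norm (s i x) \<le> 2 * norm (f x)" "AE x in M. \<bar>s i x\<bar> \<le> 2 * \<bar>f x\<bar>" for i
    using lim.hyps(3) by (auto intro: AE_I2)
  have conv: "AE x in M. (\<lambda>i. s i x) \<longlonglongrightarrow> f x"
    using lim.hyps(2) by (rule AE_I2)
  have 1: "(\<lambda>i. \<integral>x. s i x \<partial>perturbed) \<longlonglongrightarrow> (\<integral>x. f x \<partial>perturbed)"
    by (rule integral_dominated_convergence[where w = "\<lambda>x. 2 * norm (f x)"])
       (use lim.hyps(1,4) integrable_perturbed in \<open>auto intro!: AE_perturbed dom conv simp: borel_measurable_integrable\<close>)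
  have 2: "(\<lambda>i. \<integral>x. s i x \<partial>M) \<longlonglongrightarrow> (\<integral>x. f x \<partial>M)"
    by (rule integral_dominated_convergence[where w = "\<lambda>x. 2 * norm (f x)"])
       (use lim.hyps(1,4) conv dom in auto)
  have "(\<lambda>i. \<Lambda> (s i)) \<longlonglongrightarrow> \<Lambda> f"
    by (rule dominated_limit[where g = "\<lambda>x. 2 * norm (f x)"])
       (use lim.hyps(1,4) conv dom in auto)
  with 2 have "(\<lambda>i. (\<integral>x. s i x \<partial>M) + \<Lambda> (s i) / (2 * K)) \<longlonglongrightarrow> (\<integral>x. f x \<partial>M) + \<Lambda> f / (2 * K)"
    using K_pos by (intro tendsto_intros) auto
  then show ?case
    using 1 unfolding lim.IH by (rule LIMSEQ_unique[rotated])
qed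

end

section \<open>Densities and distribution functions\<close>

text \<open>
  Lebesgue's differentiation theorem for right difference quotients, applied to \<open>w\<close> and to its
  reflection \<open>w (- x)\<close>, yields both one-sided derivatives.
\<close>

lemma AE_cdf_has_derivative_density:
  fixes w :: "real \<Rightarrow> real"
  assumes w: "integrable lborel w" "\<And>x. 0 \<le> w x"
    and N: "N = density lborel (\<lambda>x. ennreal (w x))"
  shows "AE u in lborel. (cdf N has_real_derivative w u) (at u)"
proof -
  have [measurable]: "w \<in> borel_measurable borel" using w(1) by auto
  interpret N: finite_borel_measure N
  proof (intro finite_borel_measure.intro finite_borel_measure_axioms.intro finite_measureI)
    have "(\<integral>\<^sup>+ x. ennreal (w x) \<partial>lborel) < \<infinity>"
      using w by (simp add: nn_integral_eq_integral)
    then show "emeasure N (space N) \<noteq> \<infinity>"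
      by (simp add: N emeasure_density)
  qed (simp add: N)
  have int_on: "w integrable_on {a..b}" for a b
    using integrable_on_lborel[OF w(1)] integrable_on_subinterval by blast
  have ind: "integrable lborel (\<lambda>x. indicator {a<..b} x * w x)" for a b :: real
    using integrable_mult_indicator[of "{a<..b}" lborel w] w by simp
  have int_eq: "integral {a..b} w = cdf N b - cdf N a" if "a < b" for a b
  proof -
    have "emeasure N {a<..b} = (\<integral>\<^sup>+x. ennreal (indicator {a<..b} x * w x) \<partial>lborel)"
      unfolding N by (subst emeasure_density) (auto intro!: nn_integral_cong split: split_indicator)
    also have "\<dots> = ennreal (LINT x:{a<..b}|lborel. w x)"
      unfolding set_lebesgue_integral_def using w
      by (subst nn_integral_eq_integral) (auto intro!: ind)
    finally have "measure N {a<..b} = (LINT x:{a<..b}|lborel. w x)"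
      unfolding measure_def set_lebesgue_integral_def using w by (simp add: integral_nonneg_AE)
    also have "\<dots> = integral {a<..b} w"
      by (rule set_borel_integral_eq_integral(2)) (simp add: set_integrable_def ind)
    also have "\<dots> = integral {a..b} w"
      by (rule integral_spike_set) (auto intro: negligible_subset[of "{a}"])
    finally show ?thesis using N.cdf_diff_eq[OF that] by simp
  qed
  obtain N1 where N1: "negligible N1" and right: "\<And>x e. x \<notin> N1 \<Longrightarrow> 0 < e \<Longrightarrow>
      \<exists>d>0. \<forall>h. 0 < h \<and> h < d \<longrightarrow> norm (integral (cbox x (x + h *\<^sub>R One)) w /\<^sub>R h ^ DIM(real) - w x) < e"
    using integrable_ccontinuous_explicit[of w] int_on by (metis box_real(2))
  have int_minus: "(\<lambda>x. w (- x)) integrable_on {a..b}" for a b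
    using int_on[of "-b" "-a"] Henstock_Kurzweil_Integration.integrable_reflect_real[where f = w and a = "-b" and b = "-a"] by simp
  obtain N2 where N2: "negligible N2" and left: "\<And>x e. x \<notin> N2 \<Longrightarrow> 0 < e \<Longrightarrow>
      \<exists>d>0. \<forall>h. 0 < h \<and> h < d \<longrightarrow> norm (integral (cbox x (x + h *\<^sub>R One)) (\<lambda>x. w (- x)) /\<^sub>R h ^ DIM(real) - w (- x)) < e"
    using integrable_ccontinuous_explicit[of "\<lambda>x. w (- x)"] int_minus by (metis box_real(2))
  have deriv: "(cdf N has_real_derivative w u) (at u)" if u: "u \<notin> N1 \<union> uminus ` N2" for u
    unfolding DERIV_def LIM_def
  proof (intro allI impI)
    fix e :: real assume e: "e > 0"
    have u': "u \<notin> N1" "- u \<notin> N2"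
      using u by (auto simp: image_iff)
    obtain d1 where d1: "d1 > 0" "\<And>h. 0 < h \<Longrightarrow> h < d1 \<Longrightarrow> \<bar>integral {u..u + h} w / h - w u\<bar> < e"
      using right[OF u'(1) e] by (auto simp: divide_inverse mult.commute)
    obtain d2 where d2: "d2 > 0" "\<And>h. 0 < h \<Longrightarrow> h < d2 \<Longrightarrow> \<bar>integral {-u..-u + h} (\<lambda>x. w (- x)) / h - w u\<bar> < e"
      using left[OF u'(2) e] by (auto simp: divide_inverse mult.commute)
    show "\<exists>d>0. \<forall>h. h \<noteq> 0 \<and> dist h 0 < d \<longrightarrow> dist ((cdf N (u + h) - cdf N u) / h) (w u) < e"
    proof (intro exI[of _ "min d1 d2"] conjI allI impI)
      show "0 < min d1 d2" using d1 d2 by simp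
      fix h :: real assume h: "h \<noteq> 0 \<and> dist h 0 < min d1 d2"
      show "dist ((cdf N (u + h) - cdf N u) / h) (w u) < e"
      proof (cases "h > 0")
        case True
        then show ?thesis using d1(2)[of h] h by (simp add: int_eq dist_real_def)
      next
        case False
        define k where "k = - h"
        have k: "0 < k" "k < d2" using False h by (auto simp: k_def dist_real_def)
        have "integral {-u..-u + k} (\<lambda>x. w (- x)) = integral {u - k..u} w"
          using Henstock_Kurzweil_Integration.integral_reflect_real[where f = w and b = u and a = "u - k"] by simp
        also have "\<dots> = cdf N u - cdf N (u - k)" using k by (simp add: int_eq)
        finally show ?thesis
          using d2(2)[OF k] by (simp add: k_def dist_real_def minus_divide_left[symmetric] divide_simps split: if_splits)
      qed
    qed
  qed
  have "(uminus :: real \<Rightarrow> real) differentiable_on N2"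
    by (rule linear_imp_differentiable_on) (auto intro: linearI)
  then have "negligible (uminus ` N2)"
    by (rule negligible_differentiable_image_negligible[OF order_refl N2])
  with N1 have "negligible (N1 \<union> uminus ` N2)" by (rule negligible_Un)
  then have "AE u in lebesgue. u \<notin> N1 \<union> uminus ` N2"
    by (intro AE_not_in) (simp add: negligible_iff_null_sets)
  then have "AE u in lebesgue. (cdf N has_real_derivative w u) (at u)"
    by eventually_elim (rule deriv)
  then show ?thesis
    by (simp add: AE_completion_iff)
qed

text \<open>
  The positive part of \<open>ln w / (1 + u\<^sup>2)\<close> is at most \<open>w\<close>, so the hypothesis forces the negative part to
  have a finite integral; this excludes zeros of \<open>w\<close> on a set of positive measure.
\<close>

lemma ext_integral_log_finite:
  fixes w :: "real \<Rightarrow> real"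
  assumes w: "integrable lborel w" "\<And>x. 0 \<le> w x"
    and fin: "ext_integral lborel (\<lambda>u. ext_log (w u) / ereal (1 + u\<^sup>2)) > - \<infinity>"
  shows "AE u in lborel. 0 < w u" and "integrable lborel (\<lambda>u. ln (w u) / (1 + u\<^sup>2))"
proof -
  have [measurable]: "w \<in> borel_measurable borel" using w(1) by auto
  let ?g = "\<lambda>u. ext_log (w u) / ereal (1 + u\<^sup>2)"
  have [measurable]: "?g \<in> borel_measurable borel"
    unfolding ext_log_def divide_ereal_def by measurable
  have pos: "0 < 1 + u\<^sup>2" for u :: real by (simp add: add_pos_nonneg)
  have g_pos: "?g u = ereal (ln (w u) / (1 + u\<^sup>2))" if "0 < w u" for u
    using that pos[of u] by (simp add: ext_log_def)
  have g_zero: "?g u = - \<infinity>" if "\<not> 0 < w u" for u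
    using that pos[of u] by (simp add: ext_log_def divide_ereal_def)
  have "e2ennreal (?g u) \<le> ennreal (w u)" for u
  proof (cases "0 < w u")
    case True
    have "ln (w u) / (1 + u\<^sup>2) \<le> w u"
    proof (cases "0 \<le> ln (w u)")
      case t: True
      have "ln (w u) / (1 + u\<^sup>2) \<le> ln (w u) / 1"
        using t pos[of u] by (intro divide_left_mono) auto
      then show ?thesis using ln_le_minus_one[OF True] by simp
    next
      case False
      then have "ln (w u) / (1 + u\<^sup>2) \<le> 0" using pos[of u] by (simp add: divide_le_0_iff)
      then show ?thesis using True by simp
    qed
    then show ?thesis using True by (simp add: g_pos e2ennreal_ereal ennreal_leI)
  next
    case False
    then show ?thesis by (simp add: g_zero e2ennreal_neg)
  qed
  then have "(\<integral>\<^sup>+u. e2ennreal (?g u) \<partial>lborel) \<le> (\<integral>\<^sup>+u. ennreal (w u) \<partial>lborel)"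
    by (intro nn_integral_mono)
  also have "\<dots> < \<infinity>" using w by (simp add: nn_integral_eq_integral)
  finally have P: "(\<integral>\<^sup>+u. e2ennreal (?g u) \<partial>lborel) < \<infinity>" .
  have Q: "(\<integral>\<^sup>+u. e2ennreal (- ?g u) \<partial>lborel) < \<infinity>"
  proof (rule ccontr)
    assume "\<not> ?thesis"
    then have Q: "(\<integral>\<^sup>+u. e2ennreal (- ?g u) \<partial>lborel) = \<infinity>" by (simp add: not_less top_unique)
    obtain p where "(\<integral>\<^sup>+u. e2ennreal (?g u) \<partial>lborel) = ennreal p" "0 \<le> p"
      using P by (cases "\<integral>\<^sup>+u. e2ennreal (?g u) \<partial>lborel") auto
    then show False
      using fin Q unfolding ext_integral_def by (simp add: enn2ereal_ennreal)
  qed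
  have "AE u in lborel. e2ennreal (- ?g u) \<noteq> \<infinity>"
    by (rule nn_integral_PInf_AE) (use Q in auto)
  then show AE: "AE u in lborel. 0 < w u"
  proof eventually_elim
    case (elim u)
    then show ?case using g_zero[of u] by (cases "0 < w u") auto
  qed
  show "integrable lborel (\<lambda>u. ln (w u) / (1 + u\<^sup>2))"
  proof (rule integrableI_bounded)
    have "(\<integral>\<^sup>+u. ennreal (norm (ln (w u) / (1 + u\<^sup>2))) \<partial>lborel) \<le>
        (\<integral>\<^sup>+u. e2ennreal (?g u) + e2ennreal (- ?g u) \<partial>lborel)"
    proof (rule nn_integral_mono_AE)
      show "AE u in lborel. ennreal (norm (ln (w u) / (1 + u\<^sup>2))) \<le> e2ennreal (?g u) + e2ennreal (- ?g u)"
        using AE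
      proof eventually_elim
        case (elim u)
        let ?x = "ln (w u) / (1 + u\<^sup>2)"
        have "ennreal (norm x) = ennreal x + ennreal (- x)" for x :: real
          by (cases "0 \<le> x") (simp_all add: ennreal_neg)
        from this[of ?x] have "ennreal (norm ?x) = ennreal ?x + ennreal (- ?x)" .
        then show ?case unfolding g_pos[OF elim] by (simp add: e2ennreal_ereal)
      qed
    qed
    also have "\<dots> = (\<integral>\<^sup>+u. e2ennreal (?g u) \<partial>lborel) + (\<integral>\<^sup>+u. e2ennreal (- ?g u) \<partial>lborel)"
      by (rule nn_integral_add) auto
    also have "\<dots> < \<infinity>" using P Q by simp
    finally show "(\<integral>\<^sup>+u. ennreal (norm (ln (w u) / (1 + u\<^sup>2))) \<partial>lborel) < \<infinity>" .
  qed auto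
qed

definition right_limit :: "(real \<Rightarrow> real) \<Rightarrow> real \<Rightarrow> real" where
  "right_limit \<sigma> x = Lim (at_right x) \<sigma>"

lemma stieltjes_measure_eq: "stieltjes_measure \<sigma> = interval_measure (right_limit \<sigma>)"
  by (simp add: stieltjes_measure_def right_limit_def[abs_def])

lemma
  fixes \<sigma> :: "real \<Rightarrow> real"
  assumes \<sigma>: "mono \<sigma>"
  shows le_right_limit: "\<sigma> x \<le> right_limit \<sigma> x"
    and right_limit_le: "x < y \<Longrightarrow> right_limit \<sigma> x \<le> \<sigma> y"
    and mono_right_limit: "mono (right_limit \<sigma>)"
    and right_limit_right_cont: "continuous (at_right x) (right_limit \<sigma>)"
proof -
  let ?F = "right_limit \<sigma>"
  have bdd: "bdd_below (\<sigma> ` {x<..})" for x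
    using monoD[OF \<sigma>] by (intro bdd_belowI[of _ "\<sigma> x"]) (auto simp: less_imp_le)
  have F: "?F x = Inf (\<sigma> ` {x<..})" for x
  proof -
    have "(\<sigma> \<longlongrightarrow> Inf (\<sigma> ` ({x<..} \<inter> UNIV))) (at x within ({x<..} \<inter> UNIV))"
      by (rule Lim_right_bound[where K = "\<sigma> x"]) (use monoD[OF \<sigma>] in \<open>auto simp: less_imp_le\<close>)
    then show ?thesis
      unfolding right_limit_def by (intro tendsto_Lim) auto
  qed
  show le: "\<sigma> x \<le> ?F x" for x
    unfolding F using monoD[OF \<sigma>] by (intro cInf_greatest) (auto simp: less_imp_le)
  show ge: "?F x \<le> \<sigma> y" if "x < y" for x y
    unfolding F using that by (intro cInf_lower bdd) auto
  show mono: "mono ?F"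
  proof (rule monoI)
    fix x y :: real assume "x \<le> y"
    then show "?F x \<le> ?F y" using le[of y] ge[of x y] by (cases "x = y") auto
  qed
  show "continuous (at_right x) ?F"
    unfolding continuous_within
  proof (rule tendstoI)
    fix e :: real assume e: "e > 0"
    have "Inf (\<sigma> ` {x<..}) < ?F x + e" using e by (simp add: F)
    then obtain y where y: "x < y" "\<sigma> y < ?F x + e"
      using bdd by (subst (asm) cInf_less_iff) auto
    show "\<forall>\<^sub>F z in at_right x. dist (?F z) (?F x) < e"
      using eventually_at_right_less[of x] eventually_at_right_real[OF y(1)]
    proof eventually_elim
      case (elim z)
      then have "?F x \<le> ?F z" "?F z \<le> \<sigma> y" using monoD[OF mono, of x z] ge[of z y] by auto
      then show ?case using y by (simp add: dist_real_def)
    qed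
  qed
qed

lemma finite_borel_measure_stieltjes:
  assumes "mono \<sigma>" "bounded (range \<sigma>)"
  shows "finite_borel_measure (stieltjes_measure \<sigma>)"
proof (intro finite_borel_measure.intro finite_borel_measure_axioms.intro finite_measureI)
  define F where "F = right_limit \<sigma>"
  note F = le_right_limit[OF assms(1), folded F_def] right_limit_le[OF assms(1), folded F_def]
    mono_right_limit[OF assms(1), folded F_def] right_limit_right_cont[OF assms(1), folded F_def]
  have M: "stieltjes_measure \<sigma> = interval_measure F"
    by (simp add: stieltjes_measure_eq F_def)
  obtain B where B: "\<And>x. \<bar>\<sigma> x\<bar> \<le> B"
    using assms(2) by (auto simp: bounded_iff)
  have "emeasure (interval_measure F) (\<Union>i::nat. {- real i<..real i}) =
      (SUP i. emeasure (interval_measure F) {- real i<..real i})"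
    by (rule SUP_emeasure_incseq[symmetric]) (auto simp: incseq_def)
  also have "\<dots> \<le> ennreal (2 * B)"
  proof (rule SUP_least)
    fix i :: nat
    have "F (real i) - F (- real i) \<le> \<sigma> (real i + 1) - \<sigma> (- real i)"
      using F(1)[of "- real i"] F(2)[of "real i" "real i + 1"] by simp
    also have "\<dots> \<le> 2 * B" using B[of "real i + 1"] B[of "- real i"] by linarith
    finally show "emeasure (interval_measure F) {- real i<..real i} \<le> ennreal (2 * B)"
      using F(3,4) by (subst emeasure_interval_measure_Ioc) (auto simp: mono_def ennreal_leI)
  qed
  also have "\<dots> < \<infinity>" by simp
  finally show "emeasure (stieltjes_measure \<sigma>) (space (stieltjes_measure \<sigma>)) \<noteq> \<infinity>"
    by (simp add: M UN_Ioc_eq_UNIV)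
qed (simp add: stieltjes_measure_def)

lemma stieltjes_measure_cdf:
  assumes "finite_borel_measure \<nu>"
  shows "stieltjes_measure (cdf \<nu>) = \<nu>"
proof -
  interpret finite_borel_measure \<nu> by fact
  have "Lim (at_right x) (cdf \<nu>) = cdf \<nu> x" for x
    using cdf_is_right_cont[of x] by (intro tendsto_Lim) (auto simp: continuous_within)
  then have "stieltjes_measure (cdf \<nu>) = interval_measure (cdf \<nu>)"
    by (simp add: stieltjes_measure_def)
  also have "\<dots> = \<nu>"
  proof (rule cdf_unique')
    show "finite_borel_measure (interval_measure (cdf \<nu>))"
      using cdf_nondecreasing cdf_is_right_cont cdf_lim_at_bot cdf_lim_at_top measure_nonneg
      by (rule finite_borel_measure_interval_measure)
    show "cdf (interval_measure (cdf \<nu>)) = cdf \<nu>"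
      using cdf_nondecreasing cdf_is_right_cont cdf_lim_at_bot by (rule cdf_interval_measure)
  qed fact
  finally show ?thesis .
qed

lemma emeasure_stieltjes_point_of_increase:
  assumes \<sigma>: "mono \<sigma>" and x: "point_of_increase \<sigma> x" and e: "e > 0"
  shows "emeasure (stieltjes_measure \<sigma>) {x - e<..x + e} > 0"
proof -
  define F where "F = right_limit \<sigma>"
  note F = le_right_limit[OF \<sigma>, folded F_def] right_limit_le[OF \<sigma>, folded F_def]
    mono_right_limit[OF \<sigma>, folded F_def] right_limit_right_cont[OF \<sigma>, folded F_def]
  have "F (x - e) \<le> \<sigma> (x - e / 2)" using e by (intro F(2)) auto
  also have "\<dots> < \<sigma> (x + e / 2)" using x e by (simp add: point_of_increase_def)
  also have "\<dots> \<le> \<sigma> (x + e)" using e by (intro monoD[OF \<sigma>]) auto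
  also have "\<dots> \<le> F (x + e)" by (rule F(1))
  finally show ?thesis
    unfolding stieltjes_measure_eq F_def[symmetric] using F(3,4) e
    by (subst emeasure_interval_measure_Ioc) (auto simp: mono_def)
qed

lemma distribution_function_cdf:
  assumes "finite_borel_measure \<nu>"
    and inf: "infinite {x. \<forall>e>0. emeasure \<nu> {x - e<..x + e} > 0}"
  shows "distribution_function (cdf \<nu>)"
proof -
  interpret finite_borel_measure \<nu> by fact
  have "point_of_increase (cdf \<nu>) x" if "\<forall>e>0. emeasure \<nu> {x - e<..x + e} > 0" for x
    unfolding point_of_increase_def
  proof (intro allI impI)
    fix e :: real assume e: "e > 0"
    then have "cdf \<nu> (x + e) - cdf \<nu> (x - e) = measure \<nu> {x - e<..x + e}"
      by (intro cdf_diff_eq) auto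
    also have "\<dots> > 0" using that e by (simp add: emeasure_eq_measure)
    finally show "cdf \<nu> (x - e) < cdf \<nu> (x + e)" by simp
  qed
  then have "infinite {x. point_of_increase (cdf \<nu>) x}"
    using inf by (rule_tac infinite_super) auto
  moreover have "bounded (range (cdf \<nu>))"
    using cdf_nonneg cdf_bounded by (intro boundedI[where B = "measure \<nu> (space \<nu>)"]) auto
  ultimately show ?thesis
    by (simp add: distribution_function_def mono_def cdf_nondecreasing)
qed

section \<open>Evaluation of Laurent polynomials and indeterminacy\<close>

lemma integral_le_of_measure_le:
  fixes f :: "'a \<Rightarrow> real"
  assumes sets: "sets N = sets M" and le: "\<And>A. A \<in> sets M \<Longrightarrow> emeasure N A \<le> emeasure M A"
    and f: "integrable M f" "\<And>x. 0 \<le> f x"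
  shows "integrable N f" and "(\<integral>x. f x \<partial>N) \<le> (\<integral>x. f x \<partial>M)"
proof -
  have [measurable]: "f \<in> borel_measurable M" using f(1) by auto
  have [measurable]: "f \<in> borel_measurable N" by (simp add: measurable_cong_sets[OF sets])
  have nn: "(\<integral>\<^sup>+x. ennreal (f x) \<partial>N) \<le> (\<integral>\<^sup>+x. ennreal (f x) \<partial>M)"
    by (rule nn_integral_mono_measure) (auto simp: sets le_measure le)
  also have "\<dots> < \<infinity>" using f by (simp add: nn_integral_eq_integral)
  finally show N: "integrable N f"
    using f(2) by (intro integrableI_bounded) auto
  show "(\<integral>x. f x \<partial>N) \<le> (\<integral>x. f x \<partial>M)"
    using nn f N by (simp add: nn_integral_eq_integral)
qed

lemma integrable_laurent_polynomial:
  fixes q :: "complex poly"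
  assumes sets: "sets M = sets borel" and zero: "AE t in M. t \<noteq> 0"
    and moments: "\<And>n::int. integrable M (\<lambda>u::real. u powi n)"
  shows "integrable M (\<lambda>t. cmod (poly q (of_real t)) / \<bar>t\<bar> ^ m)"
proof -
  have [measurable]: "(\<lambda>t. poly q (of_real t :: complex)) \<in> borel_measurable borel"
    by (intro borel_measurable_continuous_onI continuous_intros)
  note [measurable_cong] = sets
  show ?thesis
  proof (rule Bochner_Integration.integrable_bound)
    show "integrable M (\<lambda>t. \<Sum>i\<le>degree q. cmod (coeff q i) * \<bar>t powi (int i - int m)\<bar>)"
      using moments by (intro Bochner_Integration.integrable_sum Bochner_Integration.integrable_mult_right integrable_abs) auto
    show "AE t in M. norm (cmod (poly q (of_real t)) / \<bar>t\<bar> ^ m) \<le>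
        norm (\<Sum>i\<le>degree q. cmod (coeff q i) * \<bar>t powi (int i - int m)\<bar>)"
      using zero
    proof eventually_elim
      case (elim t)
      have "cmod (poly q (of_real t)) / \<bar>t\<bar> ^ m \<le> (\<Sum>i\<le>degree q. cmod (coeff q i) * \<bar>t\<bar> ^ i) / \<bar>t\<bar> ^ m"
        unfolding poly_altdef
        by (intro divide_right_mono order_trans[OF norm_sum]) (auto simp: norm_mult norm_power)
      also have "\<dots> = (\<Sum>i\<le>degree q. cmod (coeff q i) * \<bar>t powi (int i - int m)\<bar>)"
        using elim by (simp add: sum_divide_distrib power_int_diff abs_divide power_abs)
      finally show ?case by (auto simp: abs_of_nonneg sum_nonneg)
    qed
  qed measurable
qed

text \<open>
  The factor \<open>1 / (1 + t\<^sup>2)\<close> on the right-hand side is the density of the Cauchy distribution up to a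
  constant. It is the reason why the functional in \<open>laurent_annihilator\<close> acts on \<open>p(t) / (1 + t\<^sup>2)\<close> rather than on
  \<open>p(t)\<close>; only this makes it vanish on the monomials.
\<close>

lemma laurent_evaluation_bound:
  fixes M :: "real measure" and w :: "real \<Rightarrow> real"
  assumes sets: "sets M = sets borel" and zero: "AE t in M. t \<noteq> 0"
    and moments: "\<And>n::int. integrable M (\<lambda>u. u powi n)"
    and [measurable]: "w \<in> borel_measurable borel" and nonneg: "\<And>x. 0 \<le> w x"
    and le: "\<And>A. A \<in> sets borel \<Longrightarrow> emeasure (density lborel (\<lambda>x. ennreal (w x))) A \<le> emeasure M A"
    and pos: "AE t in lborel. w t > 0"
    and log: "integrable lborel (\<lambda>u. ln (w u) / (1 + u\<^sup>2))"
  obtains K where "K > 0" and "\<And>q m. cmod (poly q \<i>) \<le>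
    K * (\<integral>t. cmod (poly q (of_real t)) / \<bar>t\<bar> ^ m / (1 + t\<^sup>2) \<partial>M)"
proof
  define I where "I = (\<integral>t. ln (w t) \<partial>cauchy_measure)"
  have log': "integrable cauchy_measure (\<lambda>t. ln (w t))"
  proof -
    have "integrable lborel (\<lambda>u. 1 / pi * (ln (w u) / (1 + u\<^sup>2)))"
      using log by (rule integrable_mult_right)
    then show ?thesis
      unfolding cauchy_measure_def
      by (subst integrable_density) (auto simp: add_nonneg_nonneg)
  qed
  show "1 / (pi * exp I) > 0" by simp
  fix q :: "complex poly" and m :: nat
  have [measurable]: "(\<lambda>t. poly q (of_real t :: complex)) \<in> borel_measurable borel"
    by (intro borel_measurable_continuous_onI continuous_intros)
  let ?f = "\<lambda>t. cmod (poly q (of_real t)) / \<bar>t\<bar> ^ m"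
  let ?N = "density lborel (\<lambda>x. ennreal (w x))"
  have pos1: "1 \<le> 1 + t\<^sup>2" "0 < 1 + t\<^sup>2" for t :: real
    by (auto simp: add_pos_nonneg)
  have f: "integrable M (\<lambda>t. ?f t / (1 + t\<^sup>2))"
  proof (rule Bochner_Integration.integrable_bound)
    show "integrable M ?f" by (rule integrable_laurent_polynomial[OF sets zero moments])
    show "AE t in M. norm (?f t / (1 + t\<^sup>2)) \<le> norm (?f t)"
    proof (rule AE_I2)
      fix t :: real
      have "?f t / (1 + t\<^sup>2) \<le> ?f t / 1"
        using pos1[of t] by (intro divide_left_mono) auto
      then show "norm (?f t / (1 + t\<^sup>2)) \<le> norm (?f t)" using pos1[of t] by simp
    qed
  qed (simp add: measurable_cong_sets[OF sets])
  have fN: "integrable ?N (\<lambda>t. ?f t / (1 + t\<^sup>2))"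
      "(\<integral>t. ?f t / (1 + t\<^sup>2) \<partial>?N) \<le> (\<integral>t. ?f t / (1 + t\<^sup>2) \<partial>M)"
  proof -
    have "0 \<le> ?f t / (1 + t\<^sup>2)" for t using pos1[of t] by simp
    note * = integral_le_of_measure_le[OF _ _ f this, of ?N]
    show "integrable ?N (\<lambda>t. ?f t / (1 + t\<^sup>2))"
        "(\<integral>t. ?f t / (1 + t\<^sup>2) \<partial>?N) \<le> (\<integral>t. ?f t / (1 + t\<^sup>2) \<partial>M)"
      by (rule *; simp add: sets le)+
  qed
  have eq: "1 / (pi * (1 + t\<^sup>2)) * (?f t * w t) = 1 / pi * (w t * (?f t / (1 + t\<^sup>2)))" for t
    by (simp add: mult_ac)
  have "integrable lborel (\<lambda>t. w t * (?f t / (1 + t\<^sup>2)))"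
    using fN(1) nonneg by (subst (asm) integrable_density) auto
  then have "integrable lborel (\<lambda>t. 1 / pi * (w t * (?f t / (1 + t\<^sup>2))))"
    by (rule Bochner_Integration.integrable_mult_right)
  then have fC: "has_bochner_integral cauchy_measure (\<lambda>t. ?f t * w t)
      (\<integral>t. 1 / pi * (w t * (?f t / (1 + t\<^sup>2))) \<partial>lborel)"
    unfolding eq[symmetric]
    by (subst has_bochner_integral_cauchy_measure_iff) (measurable, rule has_bochner_integral_integrable)
  have "exp I * cmod (poly q \<i>) \<le> (\<integral>t. ?f t * w t \<partial>cauchy_measure)"
    unfolding I_def using fC by (intro laurent_polynomial_at_i_le_cauchy_integral pos log') (auto simp: has_bochner_integral_iff)
  also have "\<dots> = (\<integral>t. 1 / pi * (w t * (?f t / (1 + t\<^sup>2))) \<partial>lborel)"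
    by (rule has_bochner_integral_integral_eq[OF fC])
  also have "\<dots> = 1 / pi * (\<integral>t. w t * (?f t / (1 + t\<^sup>2)) \<partial>lborel)"
    by (rule Bochner_Integration.integral_mult_right_zero)
  also have "(\<integral>t. w t * (?f t / (1 + t\<^sup>2)) \<partial>lborel) = (\<integral>t. ?f t / (1 + t\<^sup>2) \<partial>?N)"
    using nonneg by (subst integral_density) auto
  also have "1 / pi * \<dots> \<le> 1 / pi * (\<integral>t. ?f t / (1 + t\<^sup>2) \<partial>M)"
    using fN(2) by (intro mult_left_mono) auto
  finally show "cmod (poly q \<i>) \<le> 1 / (pi * exp I) * (\<integral>t. ?f t / (1 + t\<^sup>2) \<partial>M)"
    by (simp add: field_simps)
qed

text \<open>
  The functional is defined on the functions \<open>L q m\<close>, that is \<open>p(t) / (1 + t\<^sup>2)\<close> for the Laurent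
  polynomial \<open>p(t) = q(t) / t\<^sup>m\<^sup>+\<^sup>1\<close>, by evaluating \<open>p\<close> at \<open>\<i>\<close>, and then extended. Real
  polynomials are represented by complex ones that are real on the real line, so that the evaluation at
  \<open>\<i>\<close> needs no change of coefficients.
\<close>

lemma laurent_annihilator:
  fixes M :: "real measure"
  assumes fin: "finite_measure M" and sets: "sets M = sets borel" and zero: "AE t in M. t \<noteq> 0"
    and moments: "\<And>n::int. integrable M (\<lambda>u. u powi n)"
    and K: "K > 0" and bound: "\<And>q m. cmod (poly q \<i>) \<le>
      K * (\<integral>t. cmod (poly q (of_real t)) / \<bar>t\<bar> ^ m / (1 + t\<^sup>2) \<partial>M)"
  obtains \<Lambda> where "bounded_L1_functional M \<Lambda> K"
    and "\<And>n::int. \<Lambda> (\<lambda>u. u powi n) = 0" and "\<Lambda> (\<lambda>u. 1 / (1 + u\<^sup>2)) = 1"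
proof -
  interpret finite_measure M by fact
  have [measurable_cong]: "sets M = sets borel" by fact
  define X where "X = {f :: real \<Rightarrow> real. integrable M f}"
  define P where "P = (\<lambda>f :: real \<Rightarrow> real. K * (\<integral>x. \<bar>f x\<bar> \<partial>M))"
  interpret sublinear_on X P
  proof
    fix f g :: "real \<Rightarrow> real" assume fg: "f \<in> X" "g \<in> X"
    have "(\<integral>x. \<bar>f x + g x\<bar> \<partial>M) \<le> (\<integral>x. \<bar>f x\<bar> + \<bar>g x\<bar> \<partial>M)"
      using fg by (intro integral_mono) (auto simp: X_def)
    also have "\<dots> = (\<integral>x. \<bar>f x\<bar> \<partial>M) + (\<integral>x. \<bar>g x\<bar> \<partial>M)"
      using fg by (intro Bochner_Integration.integral_add) (auto simp: X_def)
    finally show "P (\<lambda>x. f x + g x) \<le> P f + P g"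
      using K by (simp add: P_def distrib_left[symmetric])
  qed (auto simp: X_def P_def abs_mult)
  \<comment> \<open>the exponent \<open>Suc m\<close> makes \<open>L q m\<close> vanish at the origin, where \<open>x / 0 = 0\<close>; so the class of these functions is closed under pointwise sums\<close>
  define L where "L = (\<lambda>q m t. Re (poly q (of_real t)) / t ^ Suc m / (1 + t\<^sup>2) :: real)"
  define G where "G = {(L q m, Re (poly q \<i> / \<i> ^ Suc m)) | q m. \<forall>t::real. poly q (of_real t) \<in> \<real>}"
  have pos1: "1 \<le> 1 + t\<^sup>2" "0 < 1 + t\<^sup>2" for t :: real
    by (auto simp: add_pos_nonneg)
  have abs_L: "\<bar>L q m t\<bar> = cmod (poly q (of_real t)) / \<bar>t\<bar> ^ Suc m / (1 + t\<^sup>2)"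
    if "poly q (of_real t) \<in> \<real>" for q m t
  proof -
    have "\<bar>Re (poly q (of_real t))\<bar> = cmod (poly q (of_real t))"
      using that by (auto elim!: Reals_cases)
    then show ?thesis
      using pos1[of t] by (simp add: L_def abs_divide abs_mult power_abs)
  qed
  have L_int: "integrable M (L q m)" for q m
  proof (rule Bochner_Integration.integrable_bound)
    show "integrable M (\<lambda>t. cmod (poly q (of_real t)) / \<bar>t\<bar> ^ Suc m)"
      by (rule integrable_laurent_polynomial[OF sets zero moments])
    have [measurable]: "(\<lambda>t. poly q (of_real t :: complex)) \<in> borel_measurable borel"
      by (intro borel_measurable_continuous_onI continuous_intros)
    show "L q m \<in> borel_measurable M"
      unfolding L_def by measurable
    show "AE t in M. norm (L q m t) \<le> norm (cmod (poly q (of_real t)) / \<bar>t\<bar> ^ Suc m)"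
    proof (rule AE_I2)
      fix t :: real
      have "norm (L q m t) = \<bar>Re (poly q (of_real t))\<bar> / \<bar>t\<bar> ^ Suc m / (1 + t\<^sup>2)"
        using pos1[of t] by (simp add: L_def abs_divide abs_mult power_abs)
      also have "\<dots> \<le> \<bar>Re (poly q (of_real t))\<bar> / \<bar>t\<bar> ^ Suc m / 1"
        using pos1[of t] by (intro divide_left_mono) auto
      also have "\<dots> \<le> cmod (poly q (of_real t)) / \<bar>t\<bar> ^ Suc m"
        by (auto intro!: divide_right_mono abs_Re_le_cmod)
      finally show "norm (L q m t) \<le> norm (cmod (poly q (of_real t)) / \<bar>t\<bar> ^ Suc m)"
        by simp
    qed
  qed
  have G: "dominated_relation G"
    unfolding dominated_relation_def
  proof (intro conjI allI impI)
    show "G \<subseteq> X \<times> UNIV" using L_int by (auto simp: G_def X_def)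
    show "(\<lambda>x. 0, 0) \<in> G"
      unfolding G_def by (intro CollectI exI[of _ 0]) (auto simp: L_def)
  next
    fix f r g s assume "(f, r) \<in> G" "(g, s) \<in> G"
    then obtain p m q n where
      f: "f = L p m" "r = Re (poly p \<i> / \<i> ^ Suc m)" "\<And>t::real. poly p (of_real t) \<in> \<real>" and
      g: "g = L q n" "s = Re (poly q \<i> / \<i> ^ Suc n)" "\<And>t::real. poly q (of_real t) \<in> \<real>"
      by (auto simp: G_def)
    define h where "h = p * monom 1 (Suc n) + q * monom 1 (Suc m)"
    have h_poly: "poly h z = poly p z * z ^ Suc n + poly q z * z ^ Suc m" for z
      by (simp add: h_def poly_monom)
    have h_Reals: "poly h (of_real t) \<in> \<real>" for t :: real
      unfolding h_poly using f(3) g(3) by (intro Reals_add Reals_mult Reals_power) auto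
    have common: "a / z ^ Suc m + b / z ^ Suc n = (a * z ^ Suc n + b * z ^ Suc m) / z ^ Suc (Suc (m + n))"
      for a b z :: "'c :: field"
    proof (cases "z = 0")
      case False
      have "z ^ Suc (Suc (m + n)) = z ^ Suc m * z ^ Suc n" by (simp add: power_add)
      then show ?thesis using False by (simp add: add_frac_eq)
    qed simp
    have "L p m t + L q n t = L h (Suc (m + n)) t" for t
    proof -
      have "Re (poly h (of_real t)) = Re (poly p (of_real t)) * t ^ Suc n + Re (poly q (of_real t)) * t ^ Suc m"
        unfolding h_poly of_real_power[symmetric] by simp
      then show ?thesis
        unfolding L_def by (simp only: add_divide_distrib[symmetric] common)
    qed
    moreover have "r + s = Re (poly h \<i> / \<i> ^ Suc (Suc (m + n)))"
      unfolding f g h_poly by (simp only: plus_complex.sel[symmetric] common)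
    ultimately show "(\<lambda>x. f x + g x, r + s) \<in> G"
      using h_Reals unfolding G_def f(1) g(1) by (intro CollectI exI[of _ h] exI[of _ "Suc (m + n)"]) auto
  next
    fix f r c assume "(f, r) \<in> G"
    then obtain p m where
      f: "f = L p m" "r = Re (poly p \<i> / \<i> ^ Suc m)" "\<And>t::real. poly p (of_real t) \<in> \<real>"
      by (auto simp: G_def)
    have "c * Re z = Re (of_real c * z)" for z by simp
    then have "c * r = Re (poly (smult (of_real c) p) \<i> / \<i> ^ Suc m)"
      unfolding f(2) by (simp only: poly_smult times_divide_eq_right)
    moreover have "(\<lambda>x. c * f x) = L (smult (of_real c) p) m"
      by (auto simp: f(1) L_def)
    ultimately show "(\<lambda>x. c * f x, c * r) \<in> G"
      unfolding G_def using f(3) by (intro CollectI exI[of _ "smult (of_real c) p"] exI[of _ m]) auto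
  next
    fix f r assume "(f, r) \<in> G"
    then obtain p m where
      f: "f = L p m" "r = Re (poly p \<i> / \<i> ^ Suc m)" "\<And>t::real. poly p (of_real t) \<in> \<real>"
      by (auto simp: G_def)
    have "r \<le> cmod (poly p \<i> / \<i> ^ Suc m)"
      unfolding f(2) by (rule complex_Re_le_cmod)
    also have "\<dots> = cmod (poly p \<i>)" by (simp add: norm_divide norm_mult norm_power)
    also have "\<dots> \<le> P f"
      using bound[of p "Suc m"] by (simp add: P_def f(1) abs_L[OF f(3)])
    finally show "r \<le> P f" .
  qed
  obtain \<Lambda> where \<Lambda>_G: "\<And>f r. (f, r) \<in> G \<Longrightarrow> \<Lambda> f = r"
    and \<Lambda>_add: "\<And>f g. f \<in> X \<Longrightarrow> g \<in> X \<Longrightarrow> \<Lambda> (\<lambda>x. f x + g x) = \<Lambda> f + \<Lambda> g"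
    and \<Lambda>_scale: "\<And>f c. f \<in> X \<Longrightarrow> \<Lambda> (\<lambda>x. c * f x) = c * \<Lambda> f"
    and \<Lambda>_le: "\<And>f. f \<in> X \<Longrightarrow> \<Lambda> f \<le> P f"
    using hahn_banach[OF G] by blast
  have functional: "bounded_L1_functional M \<Lambda> K"
  proof
    fix f :: "real \<Rightarrow> real" assume f: "integrable M f"
    have "\<Lambda> (\<lambda>x. -1 * f x) \<le> P (\<lambda>x. -1 * f x)"
      using f by (intro \<Lambda>_le) (simp add: X_def)
    then have "- \<Lambda> f \<le> P f"
      using f by (subst (asm) \<Lambda>_scale) (auto simp: X_def P_def)
    then show "\<bar>\<Lambda> f\<bar> \<le> K * (\<integral>x. \<bar>f x\<bar> \<partial>M)"
      using \<Lambda>_le[of f] f by (auto simp: X_def P_def)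
  qed (use \<Lambda>_add \<Lambda>_scale K in \<open>auto simp: X_def\<close>)
  interpret bounded_L1_functional M \<Lambda> K by fact
  show thesis
  proof
    show "bounded_L1_functional M \<Lambda> K" by fact
    fix n :: int
    define m where "m = nat \<bar>n\<bar>"
    define k where "k = nat (n + int (Suc m))"
    have "0 \<le> n + int (Suc m)" using abs_ge_minus_self[of n] by (simp add: m_def)
    then have n: "n = int k - int (Suc m)" by (simp add: k_def)
    \<comment> \<open>\<open>q(t) / t\<^sup>m\<^sup>+\<^sup>1 = t\<^sup>n (1 + t\<^sup>2)\<close>, a Laurent polynomial that vanishes at \<open>\<i>\<close>\<close>
    define q :: "complex poly" where "q = monom 1 k + monom 1 (k + 2)"
    have q: "poly q z = z ^ k * (1 + z\<^sup>2)" for z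
      by (simp add: q_def poly_monom power_add algebra_simps power2_eq_square)
    have q_real: "poly q (of_real t) = of_real (t ^ k * (1 + t\<^sup>2))" for t :: real
      by (simp add: q)
    have "(L q m, Re (poly q \<i> / \<i> ^ Suc m)) \<in> G"
      unfolding G_def using q_real Reals_of_real by (intro CollectI exI[of _ q] exI[of _ m]) auto
    from \<Lambda>_G[OF this] have "\<Lambda> (L q m) = 0" by (simp add: q)
    moreover have "\<Lambda> (L q m) = \<Lambda> (\<lambda>u. u powi n)"
    proof (rule cong_AE[OF L_int moments])
      show "AE t in M. L q m t = t powi n"
        using zero
      proof eventually_elim
        case (elim t)
        then show ?case
          unfolding n using pos1[of t] by (simp add: L_def q_real power_int_diff del: power_Suc of_nat_Suc)
      qed
    qed
    ultimately show "\<Lambda> (\<lambda>u. u powi n) = 0" by simp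
  next
    \<comment> \<open>the constant Laurent polynomial \<open>1\<close>, written as \<open>t / t\<close>\<close>
    have "(L (monom 1 1) 0, Re (poly (monom 1 1) \<i> / \<i> ^ Suc 0)) \<in> G"
      unfolding G_def by (intro CollectI exI[of _ "monom 1 1"] exI[of _ 0]) (auto simp: poly_monom)
    from \<Lambda>_G[OF this] have "\<Lambda> (L (monom 1 1) 0) = 1" by (simp add: poly_monom)
    moreover have "\<Lambda> (L (monom 1 1) 0) = \<Lambda> (\<lambda>u. 1 / (1 + u\<^sup>2))"
    proof (rule cong_AE[OF L_int])
      show "integrable M (\<lambda>u. 1 / (1 + u\<^sup>2))"
        using pos1 by (intro integrable_const_bound[where B = 1]) (auto simp: abs_divide divide_simps)
      show "AE t in M. L (monom 1 1) 0 t = 1 / (1 + t\<^sup>2)"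
        using zero by eventually_elim (simp add: L_def poly_monom)
    qed
    ultimately show "\<Lambda> (\<lambda>u. 1 / (1 + u\<^sup>2)) = 1" by simp
  qed
qed

text \<open>
  If \<open>\<Lambda>\<close> vanished on all continuous functions of compact support, then also on their dominated limit
  \<open>1 / (1 + u\<^sup>2)\<close>.
\<close>

lemma ex_compact_support_integral_neq:
  fixes M :: "real measure"
  assumes functional: "bounded_L1_functional M \<Lambda> K"
    and sets: "sets M = sets borel" and nz: "\<Lambda> (\<lambda>u. 1 / (1 + u\<^sup>2)) \<noteq> 0"
  shows "\<exists>f :: real \<Rightarrow> real. continuous_on UNIV f \<and> compact (closure {x. f x \<noteq> 0}) \<and>
    (\<integral>x. f x \<partial>M) \<noteq> (\<integral>x. f x \<partial>bounded_L1_functional.perturbed M \<Lambda> K)"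
proof (rule ccontr)
  interpret bounded_L1_functional M \<Lambda> K by fact
  assume neg: "\<not> ?thesis"
  have [measurable_cong]: "sets M = sets borel" by fact
  have pos: "0 < 1 + t\<^sup>2" "1 + t\<^sup>2 \<noteq> 0" "1 \<le> 1 + t\<^sup>2" for t :: real
    using add_pos_nonneg[of 1 "t\<^sup>2"] by auto
  \<comment> \<open>truncations of \<open>1 / (1 + t\<^sup>2)\<close>, equal to it on \<open>[-n, n]\<close> and zero outside \<open>[-n-1, n+1]\<close>\<close>
  define f where "f = (\<lambda>n (t::real). max 0 (min 1 (real n + 1 - \<bar>t\<bar>)) / (1 + t\<^sup>2))"
  have cont: "continuous_on UNIV (f n)" for n
    unfolding f_def using pos by (intro continuous_intros) auto
  have bound: "\<bar>f n t\<bar> \<le> 1" for n t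
  proof -
    have "\<bar>max 0 (min 1 (real n + 1 - \<bar>t\<bar>))\<bar> \<le> 1" by auto
    also have "1 \<le> 1 + t\<^sup>2" by (rule pos)
    finally have "\<bar>max 0 (min 1 (real n + 1 - \<bar>t\<bar>))\<bar> / (1 + t\<^sup>2) \<le> 1"
      by (subst divide_le_eq_1_pos[OF pos(1)])
    then show ?thesis by (simp only: f_def abs_divide abs_of_pos[OF pos(1)])
  qed
  have [measurable]: "f n \<in> borel_measurable borel" for n
    using cont by (rule borel_measurable_continuous_onI)
  have int: "integrable M (f n)" for n
    using bound by (intro integrable_const_bound[where B = 1]) auto
  have int1: "integrable M (\<lambda>u. 1 / (1 + u\<^sup>2))"
    using pos by (intro integrable_const_bound[where B = 1]) (auto simp: abs_divide divide_simps)
  have "\<Lambda> (f n) = 0" for n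
  proof -
    have "{x. f n x \<noteq> 0} \<subseteq> {- (real n + 1)..real n + 1}"
      by (auto simp: f_def max_def min_def split: if_splits)
    then have "compact (closure {x. f n x \<noteq> 0})"
      using bounded_subset[OF bounded_closed_interval] by (simp add: compact_closure)
    then have "(\<integral>x. f n x \<partial>M) = (\<integral>x. f n x \<partial>perturbed)"
      using neg cont by blast
    then show ?thesis
      using integral_perturbed[OF int[of n]] K_pos by simp
  qed
  moreover have "(\<lambda>n. \<Lambda> (f n)) \<longlonglongrightarrow> \<Lambda> (\<lambda>u. 1 / (1 + u\<^sup>2))"
  proof (rule dominated_limit[where g = "\<lambda>_. 1"])
    show "AE t in M. (\<lambda>n. f n t) \<longlonglongrightarrow> 1 / (1 + t\<^sup>2)"
    proof (rule AE_I2)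
      fix t :: real
      have "\<forall>\<^sub>F n in sequentially. f n t = 1 / (1 + t\<^sup>2)"
        using eventually_ge_at_top[of "nat \<lceil>\<bar>t\<bar>\<rceil>"]
      proof eventually_elim
        case (elim n)
        then have "\<bar>t\<bar> \<le> real n" by linarith
        then show ?case by (simp add: f_def)
      qed
      then show "(\<lambda>n. f n t) \<longlonglongrightarrow> 1 / (1 + t\<^sup>2)" by (rule tendsto_eventually)
    qed
  qed (use int int1 bound in auto)
  ultimately show False
    using nz by (simp add: LIMSEQ_const_iff)
qed

theorem theorem4p1:
  fixes \<sigma> \<sigma>' :: "real \<Rightarrow> real" and \<mu> :: "int \<Rightarrow> real" and \<sigma>\<^sub>a\<^sub>c :: "real measure"
  assumes "distribution_function \<sigma>"
    and "finite_moments \<sigma>"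
    and "\<And>n. \<mu> n = moment \<sigma> n"
    and "absolutely_continuous_part (stieltjes_measure \<sigma>) \<sigma>\<^sub>a\<^sub>c"
    and "\<And>u. \<sigma>' u = deriv (cdf \<sigma>\<^sub>a\<^sub>c) u"
    and "ext_integral lborel (\<lambda>u. ext_log (\<sigma>' u) / ereal (1 + u\<^sup>2)) > - \<infinity>"
  shows "strong_hamburger_indeterminate \<mu>"
proof -
  define M where "M = stieltjes_measure \<sigma>"
  have \<sigma>: "mono \<sigma>" "bounded (range \<sigma>)" "infinite {x. point_of_increase \<sigma> x}"
    using assms(1) by (auto simp: distribution_function_def)
  interpret M: finite_borel_measure M
    unfolding M_def using \<sigma>(1,2) by (rule finite_borel_measure_stieltjes)
  have sets: "sets M = sets borel" by (rule M.M_is_borel)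
  have zero0: "emeasure M {0} = 0" and moments: "\<And>n. integrable M (\<lambda>u. u powi n)"
    using assms(2) by (auto simp: finite_moments_def M_def)
  have zero: "AE t in M. t \<noteq> 0"
    using zero0 sets by (intro AE_I[where N = "{0}"]) auto

  have ac: "sets \<sigma>\<^sub>a\<^sub>c = sets borel" "absolutely_continuous lborel \<sigma>\<^sub>a\<^sub>c"
    using assms(4) by (auto simp: absolutely_continuous_part_def)
  have le: "emeasure \<sigma>\<^sub>a\<^sub>c A \<le> emeasure M A" if "A \<in> sets borel" for A
    using assms(4) that by (auto simp: absolutely_continuous_part_def M_def)
  have fin_ac: "finite_measure \<sigma>\<^sub>a\<^sub>c"
  proof (rule finite_measureI)
    have "emeasure \<sigma>\<^sub>a\<^sub>c (space \<sigma>\<^sub>a\<^sub>c) \<le> emeasure M UNIV"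
      using le[of UNIV] sets_eq_imp_space_eq[OF ac(1)] by simp
    also have "\<dots> < \<infinity>" by (simp add: less_top[symmetric])
    finally show "emeasure \<sigma>\<^sub>a\<^sub>c (space \<sigma>\<^sub>a\<^sub>c) \<noteq> \<infinity>" by simp
  qed
  obtain w where w_meas: "w \<in> borel_measurable lborel"
    and w_RN: "AE x in lborel. RN_deriv lborel \<sigma>\<^sub>a\<^sub>c x = ennreal (w x)" and w_nonneg: "\<And>x. 0 \<le> w x"
    by (rule sigma_finite_measure.real_RN_deriv[OF sigma_finite_lborel fin_ac ac(2)])
       (use ac(1) that in auto)
  have [measurable]: "w \<in> borel_measurable borel" using w_meas by simp
  have dens: "\<sigma>\<^sub>a\<^sub>c = density lborel (\<lambda>x. ennreal (w x))"
  proof -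
    have "\<sigma>\<^sub>a\<^sub>c = density lborel (RN_deriv lborel \<sigma>\<^sub>a\<^sub>c)"
      using sigma_finite_measure.density_RN_deriv[OF sigma_finite_lborel ac(2)] ac(1) by simp
    also have "\<dots> = density lborel (\<lambda>x. ennreal (w x))"
      using w_RN by (intro density_cong) auto
    finally show ?thesis .
  qed
  have w_int: "integrable lborel w"
  proof (rule integrableI_nonneg)
    have "(\<integral>\<^sup>+x. ennreal (w x) \<partial>lborel) = emeasure \<sigma>\<^sub>a\<^sub>c UNIV"
      unfolding dens by (subst emeasure_density) auto
    then show "(\<integral>\<^sup>+x. ennreal (w x) \<partial>lborel) < \<infinity>"
      using finite_measure.emeasure_finite[OF fin_ac] by (simp add: less_top[symmetric])
  qed (use w_nonneg in auto)
  have ae: "AE u in lborel. \<sigma>' u = w u"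
    using AE_cdf_has_derivative_density[OF w_int w_nonneg dens]
    by eventually_elim (simp add: assms(5) DERIV_imp_deriv)
  have "(\<integral>\<^sup>+u. e2ennreal (ext_log (\<sigma>' u) / ereal (1 + u\<^sup>2)) \<partial>lborel) =
      (\<integral>\<^sup>+u. e2ennreal (ext_log (w u) / ereal (1 + u\<^sup>2)) \<partial>lborel)"
    using ae by (auto intro!: nn_integral_cong_AE elim!: eventually_mono)
  moreover have "(\<integral>\<^sup>+u. e2ennreal (- (ext_log (\<sigma>' u) / ereal (1 + u\<^sup>2))) \<partial>lborel) =
      (\<integral>\<^sup>+u. e2ennreal (- (ext_log (w u) / ereal (1 + u\<^sup>2))) \<partial>lborel)"
    using ae by (auto intro!: nn_integral_cong_AE elim!: eventually_mono)
  ultimately have "ext_integral lborel (\<lambda>u. ext_log (\<sigma>' u) / ereal (1 + u\<^sup>2)) =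
      ext_integral lborel (\<lambda>u. ext_log (w u) / ereal (1 + u\<^sup>2))"
    by (simp only: ext_integral_def)
  note w_log = ext_integral_log_finite[OF w_int w_nonneg assms(6)[unfolded this]]

  obtain K where K: "K > 0" "\<And>q m. cmod (poly q \<i>) \<le>
      K * (\<integral>t. cmod (poly q (of_real t)) / \<bar>t\<bar> ^ m / (1 + t\<^sup>2) \<partial>M)"
    by (rule laurent_evaluation_bound[OF sets zero moments _ w_nonneg le[unfolded dens] w_log]) auto
  obtain \<Lambda> where \<Lambda>: "bounded_L1_functional M \<Lambda> K"
    and \<Lambda>_powi: "\<And>n::int. \<Lambda> (\<lambda>u. u powi n) = 0" and \<Lambda>_1: "\<Lambda> (\<lambda>u. 1 / (1 + u\<^sup>2)) = 1"
    using laurent_annihilator[OF M.finite_measure_axioms sets zero moments K] by blast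
  interpret \<Lambda>: bounded_L1_functional M \<Lambda> K by fact
  define \<nu> where "\<nu> = \<Lambda>.perturbed"
  have \<nu>: "finite_borel_measure \<nu>"
    unfolding \<nu>_def using \<Lambda>.finite_measure_perturbed sets
    by (intro finite_borel_measure.intro finite_borel_measure_axioms.intro) auto
  have st_\<nu>: "stieltjes_measure (cdf \<nu>) = \<nu>" by (rule stieltjes_measure_cdf[OF \<nu>])
  \<comment> \<open>\<open>\<nu> \<ge> M / 2\<close>, so every point of increase of \<open>\<sigma>\<close> is one of the new distribution function\<close>
  have "distribution_function (cdf \<nu>)"
  proof (rule distribution_function_cdf[OF \<nu>])
    have "emeasure \<nu> {x - e<..x + e} > 0" if "point_of_increase \<sigma> x" "e > 0" for x e
    proof -
      have "0 < emeasure M {x - e<..x + e}"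
        unfolding M_def by (rule emeasure_stieltjes_point_of_increase[OF \<sigma>(1) that])
      also have "\<dots> \<le> 2 * emeasure \<nu> {x - e<..x + e}"
        unfolding \<nu>_def by (rule \<Lambda>.emeasure_perturbed_le(2)) (simp add: sets)
      finally show ?thesis by (auto simp: zero_less_iff_neq_zero)
    qed
    then have "{x. point_of_increase \<sigma> x} \<subseteq> {x. \<forall>e>0. emeasure \<nu> {x - e<..x + e} > 0}"
      by blast
    then show "infinite {x. \<forall>e>0. emeasure \<nu> {x - e<..x + e} > 0}"
      using \<sigma>(3) by (rule infinite_super)
  qed
  moreover have "finite_moments (cdf \<nu>)"
    unfolding finite_moments_def st_\<nu>
  proof (intro conjI allI)
    show "emeasure \<nu> {0} = 0"
      using \<Lambda>.emeasure_perturbed_le(1)[of "{0}"] zero0 by (simp add: sets \<nu>_def)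
    show "integrable \<nu> (\<lambda>u. u powi n)" for n
      unfolding \<nu>_def by (rule \<Lambda>.integrable_perturbed[OF moments])
  qed
  moreover have "\<mu> n = moment (cdf \<nu>) n" for n
    unfolding moment_def st_\<nu> assms(3) unfolding \<nu>_def \<Lambda>.integral_perturbed[OF moments]
    by (simp add: \<Lambda>_powi M_def)
  ultimately have "strong_hamburger_solution \<mu> (cdf \<nu>)"
    by (simp add: strong_hamburger_solution_def)
  moreover have "strong_hamburger_solution \<mu> \<sigma>"
    using assms(1-3) by (simp add: strong_hamburger_solution_def)
  moreover have "\<not> same_distribution \<sigma> (cdf \<nu>)"
  proof -
    have "\<Lambda> (\<lambda>u. 1 / (1 + u\<^sup>2)) \<noteq> 0" by (simp add: \<Lambda>_1)
    from ex_compact_support_integral_neq[OF \<Lambda> sets this] show ?thesis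
      unfolding same_distribution_def st_\<nu> M_def[symmetric] unfolding \<nu>_def by blast
  qed
  ultimately show ?thesis
    unfolding strong_hamburger_indeterminate_def strong_hamburger_determinate_def by blast
qed

end
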